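(* Let $\mathcal H$ be a complex Hilbert space of finite dimension $n$ with $3\le n<+\infty$, and let $\varphi:\mathcal P(\mathcal H)\to\mathcal P(\mathcal H)$ be a surjective map. Then the following are equivalent. (1) There exists an integer $k_0\ge3$ such that $\varphi$ shrinks the joint spectrum of any $k_0$ projections. (2) There exists an integer $k_0\ge3$ such that $\varphi$ preserves the joint spectrum of any $k_0$ projections. (3) For any integer $k\ge3$, $\varphi$ shrinks the joint spectrum of any $k$ projections. (4) For any integer $k\ge3$, $\varphi$ preserves the joint spectrum of any $k$ projections. (5) There exists a unitary or anti-unitary $U$ on $\mathcal H$ such that $\varphi(P)=U^*PU$ for all $P\in\mathcal P(\mathcal H)$.
   Context: $\mathcal P(\mathcal H)$ denotes the set of all (orthogonal) projections on $\mathcal H$, i.e. operators $P$ with $P=P^*=P^2$. For operators $A_1,\dots,A_l$ on $\mathcal H$, the joint spectrum is $\sigma([A_1,\dots,A_l])=\{(c_1,\dots,c_l)\in\mathbb C^l: c_1A_1+\dots+c_lA_l\text{ is not invertible in }\mathcal B(\mathcal H)\}$. The map $\varphi$ shrinks (respectively preserves) the joint spectrum of any $k$ projections if $\sigma([\varphi(P_1),\dots,\varphi(P_k)])\subseteq\sigma([P_1,\dots,P_k])$ (respectively $=$) for all $P_1,\dots,P_k\in\mathcal P(\mathcal H)$. An anti-unitary is a conjugate-linear surjective isometry $U$ of $\mathcal H$; for it, $U^*=U^{-1}$. *)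

theory Defs
  imports "HOL-Analysis.Analysis"
begin

section \<open>Complex Hilbert spaces\<close>

text \<open>
  A complex inner product space is built on top of the library class of real inner product
  spaces, so that norm, topology, completeness and bounded linear maps are the library's.
  The axiom \<open>Re_cinner\<close> makes the real inner product the real part of the complex one; in
  particular \<open>norm x = sqrt (Re (cinner x x))\<close>, and positive definiteness is inherited.
  The inner product is linear in its first argument.
\<close>

class complex_inner = real_inner +
  fixes scaleC :: "complex \<Rightarrow> 'a \<Rightarrow> 'a" (infixr \<open>*\<^sub>C\<close> 75)
    and cinner :: "'a \<Rightarrow> 'a \<Rightarrow> complex"
  assumes scaleC_add_right: "c *\<^sub>C (x + y) = c *\<^sub>C x + c *\<^sub>C y"
    and scaleC_add_left: "(c + d) *\<^sub>C x = c *\<^sub>C x + d *\<^sub>C x"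
    and scaleC_scaleC: "c *\<^sub>C (d *\<^sub>C x) = (c * d) *\<^sub>C x"
    and scaleC_of_real: "complex_of_real r *\<^sub>C x = r *\<^sub>R x"
    and cinner_commute: "cinner x y = cnj (cinner y x)"
    and cinner_add_left: "cinner (x + y) z = cinner x z + cinner y z"
    and cinner_scaleC_left: "cinner (c *\<^sub>C x) y = c * cinner x y"
    and Re_cinner: "Re (cinner x y) = inner x y"

class complex_hilbert = complex_inner + complete_space

global_interpretation complex_vector: vector_space "scaleC :: complex \<Rightarrow> 'a \<Rightarrow> 'a::complex_inner"
proof
  show "1 *\<^sub>C x = x" for x :: 'a
    using scaleC_of_real[of 1 x] by simp
qed (simp_all add: scaleC_add_right scaleC_add_left scaleC_scaleC)

text \<open>The standard model \<open>complex ^ 'n\<close> is an instance.\<close>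

instantiation complex :: complex_hilbert
begin

definition scaleC_complex :: "complex \<Rightarrow> complex \<Rightarrow> complex"
  where "scaleC_complex c x = c * x"

definition cinner_complex :: "complex \<Rightarrow> complex \<Rightarrow> complex"
  where "cinner_complex x y = x * cnj y"

instance
  by standard
    (simp_all add: scaleC_complex_def cinner_complex_def inner_complex_def scaleR_conv_of_real
      algebra_simps)

end

instantiation vec :: (complex_inner, finite) complex_inner
begin

definition scaleC_vec :: "complex \<Rightarrow> ('a, 'b) vec \<Rightarrow> ('a, 'b) vec"
  where "scaleC_vec c x = (\<chi> i. c *\<^sub>C (x $ i))"

definition cinner_vec :: "('a, 'b) vec \<Rightarrow> ('a, 'b) vec \<Rightarrow> complex"
  where "cinner_vec x y = (\<Sum>i\<in>UNIV. cinner (x $ i) (y $ i))"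

instance
proof
  show "cinner x y = cnj (cinner y x)" for x y :: "('a, 'b) vec"
    unfolding cinner_vec_def by (subst cinner_commute) simp
qed (simp_all add: scaleC_vec_def cinner_vec_def inner_vec_def vec_eq_iff scaleC_add_right
      scaleC_add_left scaleC_scaleC scaleC_of_real cinner_add_left cinner_scaleC_left Re_cinner
      sum.distrib sum_distrib_left)

end

instance vec :: (complex_hilbert, finite) complex_hilbert ..


section \<open>Operators, projections and (anti-)unitaries\<close>

definition bounded_operators :: "('h::complex_hilbert \<Rightarrow> 'h) set"
  where "bounded_operators = {A. Vector_Spaces.linear scaleC scaleC A \<and> bounded_linear A}"

definition invertible_operator :: "('h::complex_hilbert \<Rightarrow> 'h) \<Rightarrow> bool"
  where "invertible_operator A \<longleftrightarrow>
    A \<in> bounded_operators \<and> (\<exists>B\<in>bounded_operators. A \<circ> B = id \<and> B \<circ> A = id)"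

definition cadjoint :: "('h::complex_hilbert \<Rightarrow> 'h) \<Rightarrow> ('h \<Rightarrow> 'h)"
  where "cadjoint A = (THE B. \<forall>x y. cinner (A x) y = cinner x (B y))"

lemma cadjoint_eqI:
  fixes A B :: "'h::complex_hilbert \<Rightarrow> 'h"
  assumes "\<And>x y. cinner (A x) y = cinner x (B y)"
  shows "cadjoint A = B"
  unfolding cadjoint_def
proof (rule the_equality)
  show "\<forall>x y. cinner (A x) y = cinner x (B y)"
    using assms by blast
next
  fix C assume "\<forall>x y. cinner (A x) y = cinner x (C y)"
  then have "inner x (C y) = inner x (B y)" for x y
    using assms by (metis Re_cinner)
  then show "C = B"
    by (metis ext vector_eq_rdot inner_commute)
qed

definition projections :: "('h::complex_hilbert \<Rightarrow> 'h) set"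
  where "projections = {P \<in> bounded_operators. cadjoint P = P \<and> P \<circ> P = P}"

definition unitary :: "('h::complex_hilbert \<Rightarrow> 'h) \<Rightarrow> bool"
  where "unitary U \<longleftrightarrow>
    U \<in> bounded_operators \<and> cadjoint U \<circ> U = id \<and> U \<circ> cadjoint U = id"

definition anti_unitary :: "('h::complex_hilbert \<Rightarrow> 'h) \<Rightarrow> bool"
  where "anti_unitary U \<longleftrightarrow>
    (\<forall>x y. U (x + y) = U x + U y) \<and> (\<forall>c x. U (c *\<^sub>C x) = cnj c *\<^sub>C U x) \<and>
    (\<forall>x. norm (U x) = norm x) \<and> surj U"


section \<open>The joint spectrum\<close>

text \<open>Tuples of operators and tuples of scalars are lists of equal length.\<close>

definition joint_spectrum :: "('h::complex_hilbert \<Rightarrow> 'h) list \<Rightarrow> complex list set"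
  where "joint_spectrum As = {cs. length cs = length As \<and>
    \<not> invertible_operator (\<lambda>x. \<Sum>i<length As. (cs ! i) *\<^sub>C (As ! i) x)}"

definition shrinks_joint_spectrum ::
  "(('h::complex_hilbert \<Rightarrow> 'h) \<Rightarrow> ('h \<Rightarrow> 'h)) \<Rightarrow> nat \<Rightarrow> bool"
  where "shrinks_joint_spectrum \<phi> k \<longleftrightarrow>
    (\<forall>Ps. length Ps = k \<and> set Ps \<subseteq> projections \<longrightarrow>
      joint_spectrum (map \<phi> Ps) \<subseteq> joint_spectrum Ps)"

definition preserves_joint_spectrum ::
  "(('h::complex_hilbert \<Rightarrow> 'h) \<Rightarrow> ('h \<Rightarrow> 'h)) \<Rightarrow> nat \<Rightarrow> bool"
  where "preserves_joint_spectrum \<phi> k \<longleftrightarrow>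
    (\<forall>Ps. length Ps = k \<and> set Ps \<subseteq> projections \<longrightarrow>
      joint_spectrum (map \<phi> Ps) = joint_spectrum Ps)"

end

theory Submission
  imports Defs
begin

text \<open>
  The substance is that a map \<open>\<phi>\<close> shrinking the joint spectrum of triples is conjugation by a unitary
  or an anti-unitary. In finite dimension an operator is invertible iff its kernel is trivial, so
  shrinking says that a nonzero kernel of \<open>a \<phi>(P) + b \<phi>(Q) + c \<phi>(R)\<close> forces one of \<open>a P + b Q + c R\<close>;
  longer tuples only enter through vanishing coefficients.

  Orthogonality survives. Taking \<open>R = 1\<close>, which \<open>\<phi>\<close> fixes, every eigenvalue of \<open>\<phi>(P) + \<phi>(Q)\<close> is one
  of \<open>P + Q\<close>. If \<open>P\<close> and \<open>Q\<close> are orthogonal these are at most \<open>1\<close>, whereas the sum of two projections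
  that are not orthogonal has an eigenvalue above \<open>1\<close> (\<open>sum_eigenvalue_above_one\<close>). For a triple with
  \<open>P + Q + R = 1\<close> the images are therefore orthogonal, and their sum is a projection with trivial kernel,
  that is, \<open>1\<close>; hence \<open>\<phi>\<close> is additive on orthogonal pairs (\<open>image_add\<close>).

  Rank one survives. Write \<open>ray u\<close> for the projection onto the line of a unit vector \<open>u\<close>. The nonzero
  eigenvalues of \<open>ray u + ray v\<close> are among \<open>1 \<plusminus> \<bar>\<langle>u, v\<rangle>\<bar>\<close>. If \<open>\<phi>\<close> killed one ray it would therefore kill every
  ray not orthogonal to it, then all rays, and by additivity also \<open>1\<close>, which is absurd
  (\<open>image_ray_nonzero\<close>). The images of the \<open>n\<close> rays of an orthonormal basis are thus nonzero and
  pairwise orthogonal, so each has rank one (\<open>image_ray\<close>). The same eigenvalues show that \<open>\<phi>\<close> preserves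
  the transition probability \<open>\<bar>\<langle>u, v\<rangle>\<bar>\<close> (\<open>image_ray_transition\<close>).

  Wigner's theorem, which is proved here in coordinates (\<open>wigner\<close>), now yields a linear or
  conjugate-linear isometry \<open>V\<close> with \<open>\<phi>(ray u) = ray (V u)\<close>. A projection is determined by the rays
  orthogonal to it and to its complement, so \<open>\<phi>(P) V = V P\<close> for all \<open>P\<close>.

  Conversely, conjugation by a unitary does not change kernels of linear combinations up to
  isomorphism. An anti-unitary conjugates the coefficients, which amounts to passing to the adjoint
  combination and so does not affect invertibility either (\<open>conjugate_combination_kernel\<close>).
\<close>

section \<open>Algebra of the complex inner product\<close>

lemma cinner_add_right: "cinner x (y + z) = cinner x y + cinner x (z::'h::complex_inner)"
  by (metis cinner_add_left cinner_commute complex_cnj_add)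

lemma cinner_scaleC_right: "cinner x (c *\<^sub>C y) = cnj c * cinner x (y::'h::complex_inner)"
  by (metis cinner_scaleC_left cinner_commute complex_cnj_mult)

lemma cinner_zero [simp]: "cinner 0 x = 0" "cinner x (0::'h::complex_inner) = 0"
  using cinner_add_left[of 0 0 x] cinner_add_right[of x 0 0] by simp_all

lemma cinner_diff_left: "cinner (x - y) z = cinner x z - cinner y (z::'h::complex_inner)"
  by (metis cinner_add_left add_diff_cancel diff_add_cancel)

lemma cinner_diff_right: "cinner x (y - z) = cinner x y - cinner x (z::'h::complex_inner)"
  by (metis cinner_diff_left cinner_commute complex_cnj_diff)

lemma cinner_sum_left: "cinner (\<Sum>i\<in>I. f i) z = (\<Sum>i\<in>I. cinner (f i) (z::'h::complex_inner))"
  by (induction I rule: infinite_finite_induct) (auto simp: cinner_add_left)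

lemma cinner_sum_right: "cinner z (\<Sum>i\<in>I. f i) = (\<Sum>i\<in>I. cinner (z::'h::complex_inner) (f i))"
  by (induction I rule: infinite_finite_induct) (auto simp: cinner_add_right)

lemma cinner_self: "cinner x x = of_real ((norm (x::'h::complex_inner))\<^sup>2)"
proof -
  have "Im (cinner x x) = 0"
    using arg_cong[OF cinner_commute[of x x], of Im] by simp
  then show ?thesis
    by (simp add: complex_eq_iff Re_cinner power2_norm_eq_inner)
qed

lemma norm_scaleC [simp]: "norm (c *\<^sub>C x) = cmod c * norm (x::'h::complex_inner)"
proof -
  have "of_real ((norm (c *\<^sub>C x))\<^sup>2) = complex_of_real ((cmod c * norm x)\<^sup>2)"
    unfolding cinner_self[symmetric] cinner_scaleC_left cinner_scaleC_right
    by (simp add: cinner_self power_mult_distrib complex_norm_square mult.assoc[symmetric]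
        del: of_real_power)
  then show ?thesis
    by (simp only: of_real_eq_iff power2_eq_iff_nonneg norm_ge_zero mult_nonneg_nonneg)
qed

lemma cinner_eqI:
  assumes "\<And>z. cinner x z = cinner (y::'h::complex_inner) z" shows "x = y"
proof -
  have "cinner (x - y) (x - y) = 0"
    unfolding cinner_diff_left using assms by simp
  then show ?thesis
    by (simp add: cinner_self)
qed

lemma scaleC_neg_one: "(-1) *\<^sub>C x = - (x::'h::complex_inner)"
  using complex_vector.scale_minus_left[of 1 x] by simp

lemma norm_cinner_le: "cmod (cinner x y) \<le> norm x * norm (y::'h::complex_inner)"
proof (cases "cinner x y = 0")
  case False
  define w where "w = sgn (cinner x y)"
  have "cnj w * cinner x y = of_real (cmod (cinner x y))"
    using False by (simp add: w_def sgn_eq field_simps complex_norm_square[symmetric] power2_eq_square)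
  then have "cmod (cinner x y) = inner x (w *\<^sub>C y)"
    by (metis Re_cinner Re_complex_of_real cinner_scaleC_right)
  also have "\<dots> \<le> norm x * norm (w *\<^sub>C y)" by (rule norm_cauchy_schwarz)
  finally show ?thesis using False by (simp add: w_def norm_sgn)
qed simp

text \<open>The equality case of the Cauchy--Schwarz inequality: comparing \<open>x\<close> with its component
  along \<open>y\<close> leaves a remainder of norm zero.\<close>

lemma parallel_if_cauchy_schwarz_sharp:
  fixes x y :: "'h::complex_inner"
  assumes "norm x = norm y" "cmod (cinner x y) = norm x * norm y"
  shows "\<exists>c. cmod c = 1 \<and> x = c *\<^sub>C y"
proof (cases "y = 0")
  case True
  then show ?thesis using assms by (intro exI[of _ 1]) auto
next
  case False
  define c where "c = cinner x y / of_real ((norm y)\<^sup>2)"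
  have c: "cmod c = 1"
    using assms False by (simp add: c_def norm_divide power2_eq_square norm_mult)
  have xy: "cinner x y = c * of_real ((norm y)\<^sup>2)"
    using False by (simp add: c_def)
  have yx: "cinner y x = cnj c * of_real ((norm y)\<^sup>2)"
    by (subst cinner_commute) (simp add: xy)
  have cc: "c * cnj c = 1"
    using c by (metis complex_norm_square of_real_1 power_one)
  have "cinner (x - c *\<^sub>C y) (x - c *\<^sub>C y) = cinner (x - c *\<^sub>C y) x + cinner (x - c *\<^sub>C y) ((- c) *\<^sub>C y)"
    by (metis cinner_add_right complex_vector.scale_minus_left uminus_add_conv_diff add.commute)
  also have "\<dots> = of_real ((norm y)\<^sup>2) * (1 - c * cnj c)"
    unfolding cinner_scaleC_right cinner_diff_left cinner_scaleC_left xy yx cinner_self assms(1)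
    by (simp add: algebra_simps)
  finally have "x - c *\<^sub>C y = 0"
    using cc by (simp add: cinner_self)
  then show ?thesis using c by auto
qed

section \<open>Orthonormal bases\<close>

definition orthonormal :: "'h::complex_inner set \<Rightarrow> bool"
  where "orthonormal S \<longleftrightarrow> (\<forall>b\<in>S. \<forall>c\<in>S. cinner b c = (if b = c then 1 else 0))"

lemma orthonormal_independent:
  assumes "orthonormal S" shows "complex_vector.independent S"
proof -
  have "u v = 0" if T: "finite T" "T \<subseteq> S" "(\<Sum>w\<in>T. u w *\<^sub>C w) = 0" "v \<in> T" for T u v
  proof -
    have "0 = cinner (\<Sum>w\<in>T. u w *\<^sub>C w) v"
      using T by simp
    also have "\<dots> = (\<Sum>w\<in>T. if w = v then u v else 0)"
      unfolding cinner_sum_left cinner_scaleC_left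
    proof (intro sum.cong refl)
      fix w assume "w \<in> T"
      then have "cinner w v = (if w = v then 1 else 0)"
        using T assms unfolding orthonormal_def by blast
      then show "u w * cinner w v = (if w = v then u v else 0)" by simp
    qed
    finally show "u v = 0" using T by simp
  qed
  then show ?thesis
    unfolding complex_vector.independent_explicit_module by blast
qed

locale orthonormal_basis =
  fixes B :: "'h::complex_hilbert set"
  assumes finite_basis: "finite B"
    and orthonormal: "orthonormal B"
    and spanning: "complex_vector.span B = UNIV"

text \<open>An orthonormal set of maximal cardinality spans, because the component of a vector orthogonal
  to the span could otherwise be normalised and added to the set.\<close>

lemma orthonormal_extends_to_basis:
  fixes D S :: "'h::complex_hilbert set"
  assumes D: "finite D" "complex_vector.span D = UNIV" and S: "orthonormal S"
  shows "\<exists>B. S \<subseteq> B \<and> orthonormal_basis B"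
proof -
  define Q where "Q T \<longleftrightarrow> S \<subseteq> T \<and> orthonormal T" for T
  have bound: "finite T \<and> card T \<le> card D" if "Q T" for T
    using complex_vector.independent_span_bound[OF D(1), where S = T] orthonormal_independent[of T]
      that D(2)
    by (auto simp: Q_def)
  have "\<exists>T. Q T \<and> (\<forall>T'. Q T' \<longrightarrow> card T' \<le> card T)"
  proof (rule ex_has_greatest_nat[where b = "Suc (card D)"])
    show "Q S" using S by (simp add: Q_def)
  qed (use bound in \<open>auto simp: less_Suc_eq_le\<close>)
  then obtain T where T: "Q T" and max: "\<And>T'. Q T' \<Longrightarrow> card T' \<le> card T" by blast
  have fin: "finite T" and ortho: "orthonormal T" and "S \<subseteq> T"
    using bound T by (auto simp: Q_def)
  have "x \<in> complex_vector.span T" for x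
  proof -
    define r where "r = x - (\<Sum>b\<in>T. cinner x b *\<^sub>C b)"
    have r_perp: "cinner r b = 0" if "b \<in> T" for b
    proof -
      have "cinner r b = cinner x b - (\<Sum>c\<in>T. if c = b then cinner x b else 0)"
        unfolding r_def cinner_diff_left cinner_sum_left cinner_scaleC_left
        using ortho that by (intro arg_cong2[where f = minus] refl sum.cong) (auto simp: orthonormal_def)
      then show ?thesis using fin that by simp
    qed
    have "r = 0"
    proof (rule ccontr)
      assume "r \<noteq> 0"
      define e where "e = of_real (1 / norm r) *\<^sub>C r"
      have e: "cinner e e = 1"
        using \<open>r \<noteq> 0\<close> by (simp add: cinner_self e_def norm_divide)
      have eb: "cinner e b = 0" if "b \<in> T" for b
        using r_perp[OF that] by (simp add: e_def cinner_scaleC_left)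
      have be: "cinner b e = 0" if "b \<in> T" for b
        using eb[OF that] cinner_commute[of b e] by simp
      have "e \<notin> T" using e eb by force
      moreover have "Q (insert e T)"
        using T e eb be unfolding Q_def orthonormal_def by auto
      ultimately show False using max[of "insert e T"] fin by simp
    qed
    then have "x = (\<Sum>b\<in>T. cinner x b *\<^sub>C b)" by (simp add: r_def)
    then show ?thesis
      by (metis (no_types, lifting) complex_vector.span_base complex_vector.span_scale
          complex_vector.span_sum)
  qed
  then have "orthonormal_basis T"
    using fin ortho by unfold_locales auto
  then show ?thesis using \<open>S \<subseteq> T\<close> by blast
qed

context orthonormal_basis
begin

sublocale finite_dimensional_vector_space "scaleC :: complex \<Rightarrow> 'h \<Rightarrow> 'h" B
  using orthonormal_independent[OF orthonormal] finite_basis spanning by unfold_locales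

lemma cinner_basis: "b \<in> B \<Longrightarrow> c \<in> B \<Longrightarrow> cinner b c = (if b = c then 1 else 0)"
  using orthonormal by (auto simp: orthonormal_def)

lemma norm_basis: "b \<in> B \<Longrightarrow> norm b = 1"
  using cinner_basis[of b b] cinner_self[of b]
  by (metis abs_norm_cancel of_real_eq_1_iff real_sqrt_abs real_sqrt_one)

text \<open>An orthonormal family indexed by \<open>B\<close> has the size of a basis, hence is one.\<close>

lemma orthonormal_family_expansion:
  fixes u :: "'h \<Rightarrow> 'h"
  assumes u: "\<And>b c. b \<in> B \<Longrightarrow> c \<in> B \<Longrightarrow> cinner (u b) (u c) = (if b = c then 1 else 0)"
  shows "(\<Sum>b\<in>B. cinner x (u b) *\<^sub>C u b) = x"
proof -
  have inj: "inj_on u B"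
    by (rule inj_onI) (metis u zero_neq_one)
  have "orthonormal (u ` B)"
    using u inj by (auto simp: orthonormal_def inj_on_def)
  then have "complex_vector.independent (u ` B)" by (rule orthonormal_independent)
  moreover have "card (u ` B) = complex_vector.dim (UNIV :: 'h set)"
    using inj by (metis card_image dimension_def dim_UNIV)
  ultimately have "UNIV \<subseteq> complex_vector.span (u ` B)"
    by (intro card_ge_dim_independent[OF subset_UNIV]) simp_all
  then have "x \<in> range (\<lambda>a. \<Sum>v\<in>u ` B. a v *\<^sub>C v)"
    using complex_vector.span_finite[of "u ` B"] finite_basis by auto
  then obtain a where "x = (\<Sum>v\<in>u ` B. a v *\<^sub>C v)" by blast
  then have a: "x = (\<Sum>b\<in>B. a (u b) *\<^sub>C u b)"
    by (simp add: sum.reindex[OF inj])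
  have "cinner x (u b) = a (u b)" if "b \<in> B" for b
  proof -
    have "cinner x (u b) = (\<Sum>c\<in>B. if c = b then a (u b) else 0)"
      unfolding a cinner_sum_left cinner_scaleC_left using that by (intro sum.cong) (auto simp: u)
    then show ?thesis using that finite_basis by simp
  qed
  then have "(\<Sum>b\<in>B. cinner x (u b) *\<^sub>C u b) = (\<Sum>b\<in>B. a (u b) *\<^sub>C u b)"
    by (intro sum.cong) auto
  then show ?thesis using a by simp
qed

lemma basis_expansion: "(\<Sum>b\<in>B. cinner x b *\<^sub>C b) = x"
  by (rule orthonormal_family_expansion) (rule cinner_basis)

section \<open>Operators in finite dimension\<close>

text \<open>Linear maps are automatically bounded, since coordinates are at most the norm.\<close>

lemma bounded_operators_iff:
  "A \<in> bounded_operators \<longleftrightarrow> (\<forall>x y. A (x + y) = A x + A (y::'h)) \<and> (\<forall>c x. A (c *\<^sub>C x) = c *\<^sub>C A x)"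
  (is "_ \<longleftrightarrow> ?lin")
proof
  assume "A \<in> bounded_operators"
  then show ?lin
    by (auto simp: bounded_operators_def Vector_Spaces.linear_iff)
next
  assume lin: ?lin
  have zero: "A 0 = 0"
    using lin by (metis complex_vector.scale_zero_left)
  have "bounded_linear A"
  proof (rule bounded_linear_intro[where K = "\<Sum>b\<in>B. norm (A b)"])
    show "A (x + y) = A x + A y" for x y using lin by blast
    show "A (r *\<^sub>R x) = r *\<^sub>R A x" for r x using lin by (metis scaleC_of_real)
    show "norm (A x) \<le> norm x * (\<Sum>b\<in>B. norm (A b))" for x
    proof -
      have sum: "A (\<Sum>b\<in>I. c b *\<^sub>C b) = (\<Sum>b\<in>I. c b *\<^sub>C A b)" for c I
        using lin zero by (induction I rule: infinite_finite_induct) auto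
      have coord: "cmod (cinner x b) \<le> norm x" if "b \<in> B" for b
        using norm_cinner_le[of x b] norm_basis[OF that] by simp
      have "norm (A x) = norm (\<Sum>b\<in>B. cinner x b *\<^sub>C A b)"
        using sum basis_expansion[of x] by metis
      also have "\<dots> \<le> (\<Sum>b\<in>B. norm x * norm (A b))"
        by (rule sum_norm_le) (auto intro: mult_right_mono coord)
      finally show ?thesis by (simp add: sum_distrib_left)
    qed
  qed
  then show "A \<in> bounded_operators"
    using lin by (auto simp: bounded_operators_def Vector_Spaces.linear_iff complex_vector.vector_space_axioms)
qed

text \<open>The constant \<open>cadjoint\<close> is a definite description; the matrix of conjugate transposed
  coefficients shows that it denotes.\<close>

lemma cinner_cadjoint:
  assumes "A \<in> bounded_operators"
  shows "cinner (A x) y = cinner x (cadjoint A (y::'h))"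
proof -
  have lin: "A (x + y) = A x + A y" "A (c *\<^sub>C x) = c *\<^sub>C A x" for x y c
    using assms by (auto simp: bounded_operators_iff)
  have zero: "A 0 = 0"
    using lin(2)[of 0 0] by simp
  have sum: "A (\<Sum>b\<in>I. c b *\<^sub>C b) = (\<Sum>b\<in>I. c b *\<^sub>C A b)" for c I
    using lin zero by (induction I rule: infinite_finite_induct) auto
  define C where "C y = (\<Sum>b\<in>B. cinner y (A b) *\<^sub>C b)" for y
  have "cinner (A x) y = cinner x (C y)" for x y
  proof -
    have "cinner (A x) y = (\<Sum>b\<in>B. cinner x b * cinner (A b) y)"
      by (subst basis_expansion[of x, symmetric])
        (simp add: sum cinner_sum_left cinner_scaleC_left)
    also have "\<dots> = cinner x (C y)"
      unfolding C_def cinner_sum_right cinner_scaleC_right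
      by (intro sum.cong refl) (metis cinner_commute mult.commute)
    finally show ?thesis .
  qed
  then show ?thesis using cadjoint_eqI[of A C] by metis
qed

lemma cadjoint_bounded:
  assumes "A \<in> bounded_operators"
  shows "cadjoint A \<in> (bounded_operators :: ('h \<Rightarrow> 'h) set)"
proof -
  have eq: "x = y" if "\<And>z. cinner z x = cinner z (y::'h)" for x y
    using that by (metis cinner_eqI cinner_commute)
  show ?thesis
    unfolding bounded_operators_iff
    by (auto intro!: eq simp: cinner_cadjoint[OF assms, symmetric] cinner_add_right
        cinner_scaleC_right)
qed

lemma invertible_iff_injective:
  assumes "A \<in> bounded_operators"
  shows "invertible_operator A \<longleftrightarrow> (\<forall>x::'h. A x = 0 \<longrightarrow> x = 0)"
proof
  assume "invertible_operator A"
  then obtain C where C: "C \<in> bounded_operators" "C \<circ> A = id"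
    by (auto simp: invertible_operator_def)
  have "C 0 = 0"
    using C(1) by (metis bounded_operators_iff complex_vector.scale_zero_left)
  then show "\<forall>x. A x = 0 \<longrightarrow> x = 0"
    using C(2) by (metis comp_apply id_apply)
next
  assume ker: "\<forall>x. A x = 0 \<longrightarrow> x = 0"
  have linA: "A (x + y) = A x + A y" "A (c *\<^sub>C x) = c *\<^sub>C A x" for x y c
    using assms by (auto simp: bounded_operators_iff)
  have "inj A"
  proof (rule injI)
    fix x y assume "A x = A y"
    then have "A (x + (-1) *\<^sub>C y) = 0"
      unfolding linA by (simp add: scaleC_neg_one)
    then show "x = y" using ker by (force simp: scaleC_neg_one)
  qed
  moreover have "surj A"
    using linear_inj_imp_surj[OF _ \<open>inj A\<close>] assms by (auto simp: bounded_operators_def)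
  ultimately have inv: "A (inv A x) = x" "inv A (A x) = x" for x
    by (simp_all add: surj_f_inv_f)
  have "inv A \<in> bounded_operators"
    unfolding bounded_operators_iff using inv linA by metis
  then show "invertible_operator A"
    using assms inv by (auto simp: invertible_operator_def fun_eq_iff intro!: bexI[of _ "inv A"])
qed

text \<open>The kernel of the adjoint is the orthogonal complement of the range, which is everything when \<open>A\<close> is
  injective.\<close>

lemma cadjoint_injective:
  assumes "A \<in> bounded_operators" "\<forall>x::'h. A x = 0 \<longrightarrow> x = 0" "cadjoint A y = 0"
  shows "y = 0"
proof -
  obtain C where C: "A \<circ> C = id"
    using invertible_iff_injective[OF assms(1)] assms(2) by (auto simp: invertible_operator_def)
  have "cinner y y = cinner (A (C y)) y"
    using C by (metis comp_apply id_apply)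
  also have "\<dots> = 0"
    by (simp add: cinner_cadjoint[OF assms(1)] assms(3))
  finally show ?thesis by (simp add: cinner_self)
qed

text \<open>The coordinates of a unit vector lie in a product of closed unit discs, which is compact by
  Tychonoff's theorem.\<close>

lemma compact_unit_sphere: "compact {x::'h. norm x = 1}"
proof -
  define K where "K = PiE UNIV (\<lambda>b::'h. cball (0::complex) 1)"
  define g where "g c = (\<Sum>b\<in>B. c b *\<^sub>C b)" for c :: "'h \<Rightarrow> complex"
  have "compact K"
    using compactin_PiE[of "\<lambda>_::'h. euclidean::complex topology" UNIV "\<lambda>_. cball 0 1"]
    by (simp add: K_def euclidean_product_topology)
  moreover have "continuous_on K g"
  proof -
    have "bounded_linear (\<lambda>z. z *\<^sub>C (b::'h))" for b
    proof (rule bounded_linear_intro[where K = "norm b"])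
      show "(x + y) *\<^sub>C b = x *\<^sub>C b + y *\<^sub>C b" for x y
        by (rule scaleC_add_left)
      show "(r *\<^sub>R x) *\<^sub>C b = r *\<^sub>R x *\<^sub>C b" for r x
        by (metis scaleC_of_real scaleC_scaleC scaleR_conv_of_real)
    qed simp
    then have "continuous_on K (\<lambda>c. c b *\<^sub>C b)" for b
      by (rule bounded_linear.continuous_on)
        (rule continuous_on_subset[OF continuous_on_product_coordinates subset_UNIV])
    then show ?thesis unfolding g_def by (intro continuous_intros)
  qed
  ultimately have "compact (g ` K)" by (rule compact_continuous_image[rotated])
  moreover have "{x. norm x = 1} \<subseteq> g ` K"
  proof
    fix x :: 'h assume x: "x \<in> {x. norm x = 1}"
    have "cmod (cinner x b) \<le> 1" if "b \<in> B" for b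
      using norm_cinner_le[of x b] norm_basis[OF that] x by simp
    then have "(\<lambda>b. if b \<in> B then cinner x b else 0) \<in> K"
      by (auto simp: K_def)
    moreover have "g (\<lambda>b. if b \<in> B then cinner x b else 0) = x"
      using basis_expansion[of x] by (simp add: g_def cong: sum.cong)
    ultimately show "x \<in> g ` K" by force
  qed
  moreover have "closed {x::'h. norm x = 1}"
    by (intro closed_Collect_eq continuous_intros)
  ultimately show ?thesis
    by (metis compact_Int_closed inf.absorb_iff2 inf_commute)
qed

end

section \<open>Eigenvalues of self-adjoint operators and projections\<close>

lemma inner_selfadjoint:
  assumes "\<forall>x y. cinner (A x) y = cinner x (A (y::'h::complex_hilbert))"
  shows "inner (A x) y = inner x (A y)"
  using assms by (metis Re_cinner)

context orthonormal_basis
begin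

text \<open>A maximiser \<open>u\<close> of the quadratic form on the unit sphere is an eigenvector: with the maximum \<open>M\<close>,
  the form of \<open>M - A\<close> is nonnegative and vanishes at \<open>u\<close>, so its derivative at \<open>u\<close> in the direction
  \<open>w = M u - A u\<close>, which is \<open>2 \<parallel>w\<parallel>\<^sup>2\<close>, has to vanish too.\<close>

lemma selfadjoint_eigenvector_above:
  assumes A: "A \<in> bounded_operators" and sa: "\<forall>x y. cinner (A x) y = cinner x (A (y::'h))"
    and v: "inner (A v) v > m * (norm v)\<^sup>2"
  shows "\<exists>M x. M > m \<and> x \<noteq> 0 \<and> A x = of_real M *\<^sub>C x"
proof -
  interpret A: bounded_linear A using A by (simp add: bounded_operators_def)
  note sa' = inner_selfadjoint[OF sa]
  have "v \<noteq> 0" using v by auto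
  have "norm ((1 / norm v) *\<^sub>R v) = 1" using \<open>v \<noteq> 0\<close> by simp
  then have "{x::'h. norm x = 1} \<noteq> {}" by blast
  moreover have "continuous_on {x::'h. norm x = 1} (\<lambda>x. inner (A x) x)"
    by (intro continuous_intros A.continuous_on)
  ultimately obtain u where u: "norm u = 1" "\<And>y. norm y = 1 \<Longrightarrow> inner (A y) y \<le> inner (A u) u"
    using continuous_attains_sup[OF compact_unit_sphere] by auto
  define M where "M = inner (A u) u"
  have le: "inner (A x) x \<le> M * (norm x)\<^sup>2" for x
  proof (cases "x = 0")
    case False
    have "inner (A ((1 / norm x) *\<^sub>R x)) ((1 / norm x) *\<^sub>R x) \<le> M"
      using u(2)[of "(1 / norm x) *\<^sub>R x"] False by (simp add: M_def)
    then show ?thesis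
      using False by (simp add: A.scaleR field_simps power2_eq_square)
  qed simp
  define w where "w = M *\<^sub>R u - A u"
  define c where "c = M * (norm w)\<^sup>2 - inner (A w) w"
  have quad: "0 \<le> 2 * s * inner w w + s * s * c" for s
  proof -
    have u2: "inner u u = 1" using u(1) by (simp add: dot_square_norm)
    have le_s: "inner (A (u + s *\<^sub>R w)) (u + s *\<^sub>R w) \<le> M * inner (u + s *\<^sub>R w) (u + s *\<^sub>R w)"
      using le[of "u + s *\<^sub>R w"] by (simp add: dot_square_norm)
    have Aq: "inner (A (u + s *\<^sub>R w)) (u + s *\<^sub>R w) = M + 2 * s * inner (A u) w + s * s * inner (A w) w"
      using sa'[of w u] by (simp add: A.add A.scaleR inner_simps M_def inner_commute algebra_simps)
    have Iq: "inner (u + s *\<^sub>R w) (u + s *\<^sub>R w) = 1 + 2 * s * inner u w + s * s * inner w w"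
      using u2 by (simp add: inner_simps inner_commute algebra_simps)
    have ww: "inner w w = M * inner u w - inner (A u) w"
      by (subst w_def) (simp add: inner_simps)
    have "2 * s * (M * inner u w - inner (A u) w) + s * s * (M * inner w w - inner (A w) w) =
        M * (1 + 2 * s * inner u w + s * s * inner w w) - (M + 2 * s * inner (A u) w + s * s * inner (A w) w)"
      by (simp add: algebra_simps)
    then show ?thesis
      using le_s unfolding Aq Iq c_def dot_square_norm[symmetric] ww[symmetric] by linarith
  qed
  have "w = 0"
  proof (rule ccontr)
    assume "w \<noteq> 0"
    then have d: "inner w w > 0" by simp
    define s where "s = - inner w w / (1 + \<bar>c\<bar>)"
    have "s < 0" using d by (simp add: s_def)
    have "\<bar>s * c\<bar> \<le> inner w w"
      using d by (simp add: s_def abs_mult field_simps)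
    then have "2 * inner w w + s * c > 0" using d by linarith
    then have "s * (2 * inner w w + s * c) < 0" using \<open>s < 0\<close> by (rule mult_neg_pos[rotated])
    then show False using quad[of s] by (simp add: algebra_simps)
  qed
  then have "A u = of_real M *\<^sub>C u" by (simp add: w_def scaleC_of_real)
  moreover have "m < M"
  proof -
    have "m * (norm v)\<^sup>2 < M * (norm v)\<^sup>2" using v le[of v] by linarith
    then show ?thesis by (simp add: mult_less_cancel_right)
  qed
  moreover have "u \<noteq> 0" using u(1) by auto
  ultimately show ?thesis by blast
qed

lemma projections_iff:
  "P \<in> projections \<longleftrightarrow> (\<forall>x y. P (x + y) = P x + P (y::'h)) \<and> (\<forall>c x. P (c *\<^sub>C x) = c *\<^sub>C P x) \<and>
    (\<forall>x y. cinner (P x) y = cinner x (P y)) \<and> (\<forall>x. P (P x) = P x)"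
proof -
  have "cadjoint P = P \<longleftrightarrow> (\<forall>x y. cinner (P x) y = cinner x (P y))" if "P \<in> bounded_operators"
    using cinner_cadjoint[OF that] cadjoint_eqI[of P P] by metis
  then show ?thesis
    unfolding projections_def bounded_operators_iff by (auto simp: fun_eq_iff)
qed

lemma projectionD:
  assumes "P \<in> projections"
  shows "P (x + y) = P x + P (y::'h)" "P (c *\<^sub>C x) = c *\<^sub>C P x"
    "cinner (P x) y = cinner x (P y)" "P (P x) = P x" "P 0 = 0" "P (x - y) = P x - P y"
    "P \<in> bounded_operators"
proof -
  show 1: "P (x + y) = P x + P y" "P (c *\<^sub>C x) = c *\<^sub>C P x" for x y c
    using assms by (auto simp: projections_iff)
  show "cinner (P x) y = cinner x (P y)" "P (P x) = P x" "P \<in> bounded_operators"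
    using assms by (auto simp: projections_iff bounded_operators_iff)
  show "P 0 = 0" using 1(2)[of 0 0] by simp
  show "P (x - y) = P x - P y" using 1(1)[of "x - y" y] by (simp add: eq_diff_eq)
qed

lemma id_projection: "(\<lambda>x::'h. x) \<in> projections"
  and zero_projection: "(\<lambda>x::'h. 0) \<in> projections"
  by (auto simp: projections_iff)

lemma projection_diff_id:
  assumes P: "P \<in> projections" shows "(\<lambda>x::'h. x - P x) \<in> projections"
  unfolding projections_iff
  by (simp add: complex_vector.scale_right_diff_distrib cinner_diff_left cinner_diff_right
      projectionD[OF P])

lemma orthogonal_projections_swap:
  assumes "P \<in> projections" "Q \<in> projections" "\<forall>x::'h. P (Q x) = 0"
  shows "Q (P x) = 0"
proof (rule cinner_eqI)
  fix z show "cinner (Q (P x)) z = cinner 0 z"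
    by (simp add: projectionD(3)[OF assms(1)] projectionD(3)[OF assms(2)] assms(3))
qed

lemma projection_add:
  assumes "P \<in> projections" "Q \<in> projections" "\<forall>x::'h. P (Q x) = 0"
  shows "(\<lambda>x. P x + Q x) \<in> projections"
  unfolding projections_iff
  by (simp add: scaleC_add_right cinner_add_left cinner_add_right assms(3)
      orthogonal_projections_swap[OF assms] projectionD[OF assms(1)] projectionD[OF assms(2)])

end

text \<open>Along a unit vector \<open>v\<close> in the range of \<open>P\<close> the quadratic form of \<open>P + Q\<close> takes the value
  \<open>1 + \<parallel>Q v\<parallel>\<^sup>2\<close>.\<close>

lemma (in orthonormal_basis) sum_eigenvalue_above_one:
  assumes P: "P \<in> projections" and Q: "Q \<in> projections" and "Q (P z) \<noteq> (0::'h)"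
  shows "\<exists>M x. M > (1::real) \<and> x \<noteq> 0 \<and> P x + Q x = of_real M *\<^sub>C x"
proof -
  define v where "v = P z"
  have "inner (P v + Q v) v = inner v v + inner (Q v) (Q v)"
    using projectionD(4)[OF P, of z] projectionD(4)[OF Q, of v] inner_selfadjoint[of Q "Q v" v]
      projectionD(3)[OF Q] by (simp add: v_def inner_add_left)
  moreover have "inner (Q v) (Q v) > 0"
    using assms(3) by (simp add: v_def)
  ultimately have "inner (P v + Q v) v > 1 * (norm v)\<^sup>2"
    by (simp add: dot_square_norm)
  moreover have "(\<lambda>x. P x + Q x) \<in> bounded_operators"
    unfolding bounded_operators_iff by (simp add: projectionD[OF P] projectionD[OF Q] scaleC_add_right)
  moreover have "\<forall>x y. cinner (P x + Q x) y = cinner x (P y + Q y)"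
    by (simp add: cinner_add_left cinner_add_right projectionD[OF P] projectionD[OF Q])
  ultimately show ?thesis
    using selfadjoint_eigenvector_above[of "\<lambda>x. P x + Q x" 1 v] by blast
qed

section \<open>Projections of rank one\<close>

text \<open>For \<open>\<parallel>u\<parallel> = 1\<close> this is the orthogonal projection onto the line spanned by \<open>u\<close>.\<close>

definition ray :: "'h::complex_inner \<Rightarrow> 'h \<Rightarrow> 'h"
  where "ray u x = cinner x u *\<^sub>C u"

lemma (in orthonormal_basis) ray_projection: "norm u = 1 \<Longrightarrow> ray (u::'h) \<in> projections"
  by (auto simp: projections_iff ray_def cinner_self cinner_add_left cinner_scaleC_left scaleC_add_left
      scaleC_scaleC cinner_scaleC_right cinner_commute[of u])

text \<open>Every vector \<open>y\<close> in the range of \<open>ray u + ray v\<close> is determined by \<open>\<langle>y, u\<rangle>\<close> and \<open>\<langle>y, v\<rangle>\<close>,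
  and these two numbers satisfy a two by two system with eigenvalues \<open>\<plusminus> \<bar>\<langle>u, v\<rangle>\<bar>\<close> for \<open>s\<close>.\<close>

lemma ray_sum_eigenvalue:
  fixes u v y :: "'h::complex_hilbert"
  assumes "norm u = 1" "norm v = 1" "y \<noteq> 0" "ray u y + ray v y = of_real (1 + s) *\<^sub>C y" "1 + s \<noteq> 0"
  shows "s\<^sup>2 = (cmod (cinner u v))\<^sup>2"
proof -
  define p q where "p = cinner y u" and "q = cinner y v"
  have y: "of_real (1 + s) *\<^sub>C y = p *\<^sub>C u + q *\<^sub>C v"
    using assms(4) by (simp add: ray_def p_def q_def)
  have "of_real (1 + s) * p = p + q * cinner v u" "of_real (1 + s) * q = p * cinner u v + q"
    using arg_cong[OF y, of "\<lambda>x. cinner x u"] arg_cong[OF y, of "\<lambda>x. cinner x v"] assms(1,2)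
    by (simp_all add: cinner_scaleC_left cinner_add_left cinner_self p_def q_def)
  then have pq: "of_real s * p = q * cinner v u" "of_real s * q = p * cinner u v"
    by (simp_all add: algebra_simps)
  have t: "cinner u v * cinner v u = of_real ((cmod (cinner u v))\<^sup>2)"
    by (subst cinner_commute[of v u]) (rule complex_norm_square[symmetric])
  have "of_real (s\<^sup>2) * p = of_real ((cmod (cinner u v))\<^sup>2) * p"
    unfolding t[symmetric] by (simp add: power2_eq_square mult.assoc pq)
  moreover have "of_real (s\<^sup>2) * q = of_real ((cmod (cinner u v))\<^sup>2) * q"
    unfolding t[symmetric] by (simp add: power2_eq_square mult.assoc pq)
  moreover have "p \<noteq> 0 \<or> q \<noteq> 0"
  proof (rule ccontr)
    assume "\<not> (p \<noteq> 0 \<or> q \<noteq> 0)"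
    then have "of_real (1 + s) *\<^sub>C y = 0" using y by simp
    then show False using assms(3,5)
      by (metis complex_vector.scale_eq_0_iff of_real_eq_0_iff)
  qed
  ultimately show ?thesis
    by (metis mult_right_cancel of_real_eq_iff)
qed

lemma ray_sum_eigenvector:
  fixes u v :: "'h::complex_hilbert"
  assumes "norm u = 1" "norm v = 1"
  shows "\<exists>y. y \<noteq> 0 \<and> ray u y + ray v y = of_real (1 + cmod (cinner u v)) *\<^sub>C y"
proof -
  define s where "s = cmod (cinner u v)"
  \<comment> \<open>The phase turns \<open>v\<close> so that its inner product with \<open>u\<close> is nonnegative.\<close>
  define \<omega> where "\<omega> = (if cinner u v = 0 then 1 else sgn (cinner u v))"
  have \<omega>: "\<omega> * cnj \<omega> = 1"
  proof -
    have "cmod \<omega> = 1" by (simp add: \<omega>_def norm_sgn)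
    then show ?thesis by (metis complex_norm_square of_real_1 power_one)
  qed
  have uv: "cinner u v = of_real s * \<omega>"
    by (simp add: \<omega>_def s_def sgn_eq)
  then have vu: "cinner v u = of_real s * cnj \<omega>"
    by (metis cinner_commute complex_cnj_complex_of_real complex_cnj_mult)
  define y where "y = u + \<omega> *\<^sub>C v"
  have yu: "cinner y u = of_real (1 + s)"
    using \<omega> assms by (simp add: y_def cinner_add_left cinner_scaleC_left cinner_self vu)
  have yv: "cinner y v = of_real (1 + s) * \<omega>"
    using assms by (simp add: y_def cinner_add_left cinner_scaleC_left cinner_self uv algebra_simps)
  have "ray u y + ray v y = of_real (1 + s) *\<^sub>C y"
    unfolding ray_def yu yv by (simp add: y_def scaleC_add_right scaleC_scaleC del: of_real_add)
  moreover have "y \<noteq> 0"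
  proof
    assume "y = 0"
    then have "(of_real (1 + s) :: complex) = 0" using yu by simp
    then have "1 + s = 0" by (simp only: of_real_eq_0_iff)
    moreover have "s \<ge> 0" by (simp add: s_def)
    ultimately show False by simp
  qed
  ultimately show ?thesis using s_def by blast
qed

section \<open>Maps that shrink the joint spectrum\<close>

locale spectrum_shrinking = orthonormal_basis B for B :: "'h::complex_hilbert set" +
  fixes \<phi> :: "('h \<Rightarrow> 'h) \<Rightarrow> ('h \<Rightarrow> 'h)"
  assumes into: "P \<in> projections \<Longrightarrow> \<phi> P \<in> projections"
    and shrink: "P \<in> projections \<Longrightarrow> Q \<in> projections \<Longrightarrow> R \<in> projections \<Longrightarrow> x \<noteq> 0 \<Longrightarrow>
      a *\<^sub>C \<phi> P x + b *\<^sub>C \<phi> Q x + c *\<^sub>C \<phi> R x = 0 \<Longrightarrow>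
      \<exists>y. y \<noteq> 0 \<and> a *\<^sub>C P y + b *\<^sub>C Q y + c *\<^sub>C R y = 0"
begin

lemma image_id: "\<phi> (\<lambda>x. x) = (\<lambda>x. x)"
proof
  fix x
  note I = id_projection
  show "\<phi> (\<lambda>x. x) x = x"
  proof (rule ccontr)
    assume "\<phi> (\<lambda>x. x) x \<noteq> x"
    then have "x - \<phi> (\<lambda>x. x) x \<noteq> 0" by simp
    from shrink[OF I I I this, of 1 0 0] show False
      by (auto simp: projectionD[OF into[OF I]])
  qed
qed

text \<open>With the identity as third projection, shrinking bounds the spectrum of \<open>\<phi> P + \<phi> Q\<close>.\<close>

lemma eigenvalue_of_sum:
  assumes P: "P \<in> projections" and Q: "Q \<in> projections"
    and "x \<noteq> 0" "\<phi> P x + \<phi> Q x = l *\<^sub>C x"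
  shows "\<exists>y. y \<noteq> 0 \<and> P y + Q y = l *\<^sub>C y"
proof -
  have "1 *\<^sub>C \<phi> P x + 1 *\<^sub>C \<phi> Q x + (- l) *\<^sub>C \<phi> (\<lambda>x. x) x = 0"
    by (simp add: image_id assms(4))
  from shrink[OF P Q id_projection assms(3) this] show ?thesis by auto
qed

text \<open>The sum of two orthogonal projections is a projection, so it has no eigenvalue above \<open>1\<close>.\<close>

lemma image_orthogonal:
  assumes P: "P \<in> projections" and Q: "Q \<in> projections" and PQ: "\<forall>x. P (Q x) = 0"
  shows "\<phi> P (\<phi> Q x) = 0"
proof (rule ccontr)
  assume "\<phi> P (\<phi> Q x) \<noteq> 0"
  from sum_eigenvalue_above_one[OF into[OF Q] into[OF P] this]
  obtain M y where M: "M > 1" and "y \<noteq> 0" "\<phi> Q y + \<phi> P y = of_real M *\<^sub>C y" by blast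
  then have "\<phi> P y + \<phi> Q y = of_real M *\<^sub>C y" by (simp add: add.commute)
  from eigenvalue_of_sum[OF P Q \<open>y \<noteq> 0\<close> this]
  obtain z where z: "z \<noteq> 0" "P z + Q z = of_real M *\<^sub>C z" by blast
  note S = projectionD[OF projection_add[OF P Q PQ]]
  have "of_real M *\<^sub>C z = of_real M *\<^sub>C of_real M *\<^sub>C z"
    using S(4)[of z] unfolding z(2) S(2) by simp
  then have "(of_real M * of_real M - of_real M) *\<^sub>C z = 0"
    by (simp add: complex_vector.scale_left_diff_distrib)
  then have "of_real (M * M - M) = (0::complex)"
    using z(1) complex_vector.scale_eq_0_iff[of _ z] by simp
  then have "M * (M - 1) = 0" by (simp only: of_real_eq_0_iff) (simp add: algebra_simps)
  then show False using M by simp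
qed

text \<open>The images are pairwise orthogonal, so \<open>z\<close>, the part of \<open>x\<close> that they miss, is in the kernel of their
  sum. The kernel is trivial, because the three original projections add up to the identity.\<close>

lemma image_resolution:
  assumes P: "P \<in> projections" and Q: "Q \<in> projections" and PQ: "\<forall>x. P (Q x) = 0"
  shows "\<phi> P x + \<phi> Q x + \<phi> (\<lambda>x. x - (P x + Q x)) x = x"
proof (rule ccontr)
  assume neq: "\<not> ?thesis"
  define R where "R = (\<lambda>x. x - (P x + Q x))"
  have R: "R \<in> projections"
    unfolding R_def by (rule projection_diff_id[OF projection_add[OF P Q PQ]])
  have QP: "Q (P x) = 0" for x using orthogonal_projections_swap[OF P Q PQ] by simp
  have PR: "P (R x) = 0" and QR: "Q (R x) = 0" for x
    using PQ QP by (simp_all add: R_def projectionD[OF P] projectionD[OF Q])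
  have RP: "R (P x) = 0" and RQ: "R (Q x) = 0" for x
    using orthogonal_projections_swap[OF P R] orthogonal_projections_swap[OF Q R] PR QR by auto
  define z where "z = x - (\<phi> P x + \<phi> Q x + \<phi> R x)"
  have "z \<noteq> 0" using neq by (auto simp: z_def R_def)
  moreover have "1 *\<^sub>C \<phi> P z + 1 *\<^sub>C \<phi> Q z + 1 *\<^sub>C \<phi> R z = 0"
    unfolding z_def
    by (simp add: projectionD[OF into[OF P]] projectionD[OF into[OF Q]] projectionD[OF into[OF R]]
      image_orthogonal P Q R PQ QP PR QR RP RQ)
  ultimately obtain y where "y \<noteq> 0" "1 *\<^sub>C P y + 1 *\<^sub>C Q y + 1 *\<^sub>C R y = 0"
    using shrink[OF P Q R] by blast
  moreover have "P y + Q y + R y = y" unfolding R_def by simp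
  ultimately show False by simp
qed

lemma image_zero: "\<phi> (\<lambda>x. 0) = (\<lambda>x. 0)"
proof
  fix x
  have "\<phi> (\<lambda>x. 0) (\<phi> (\<lambda>x. 0) x) = 0"
    by (rule image_orthogonal[OF zero_projection zero_projection]) (rule allI, rule refl)
  then show "\<phi> (\<lambda>x. 0) x = 0"
    unfolding projectionD(4)[OF into[OF zero_projection]] .
qed

lemma image_complement:
  assumes "P \<in> projections" shows "\<phi> (\<lambda>x. x - P x) x = x - \<phi> P x"
proof -
  have "\<phi> P x + \<phi> (\<lambda>x. x - P x) x = x"
    using image_resolution[OF assms zero_projection, of x] projectionD(5)[OF assms]
    by (simp add: image_zero)
  then show ?thesis by (metis add_diff_cancel_left')
qed

lemma image_add:
  assumes P: "P \<in> projections" and Q: "Q \<in> projections" and PQ: "\<forall>x. P (Q x) = 0"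
  shows "\<phi> (\<lambda>x. P x + Q x) x = \<phi> P x + \<phi> Q x"
proof -
  have "\<phi> P x + \<phi> Q x + (x - \<phi> (\<lambda>x. P x + Q x) x) = x"
    using image_resolution[OF assms, of x]
    unfolding image_complement[OF projection_add[OF assms], of x] .
  then show ?thesis by (simp add: algebra_simps)
qed

text \<open>If \<open>u\<close> and \<open>v\<close> are not orthogonal, then \<open>1\<close> is not an eigenvalue of \<open>ray u + ray v\<close>; it would be
  one of \<open>0 + \<phi> (ray v)\<close> for a nonzero projection \<open>\<phi> (ray v)\<close>.\<close>

lemma image_ray_zero_spreads:
  assumes u: "norm u = 1" and v: "norm v = 1" and uv: "cinner u v \<noteq> 0"
    and zero: "\<phi> (ray u) = (\<lambda>x. 0)"
  shows "\<phi> (ray v) = (\<lambda>x. 0)"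
proof (rule ccontr)
  assume "\<phi> (ray v) \<noteq> (\<lambda>x. 0)"
  then obtain x where x: "\<phi> (ray v) x \<noteq> 0" by (auto simp: fun_eq_iff)
  have "\<phi> (ray u) (\<phi> (ray v) x) + \<phi> (ray v) (\<phi> (ray v) x) = 1 *\<^sub>C \<phi> (ray v) x"
    using projectionD(4)[OF into[OF ray_projection[OF v]]] by (simp add: zero)
  from eigenvalue_of_sum[OF ray_projection[OF u] ray_projection[OF v] x this]
  obtain y where "y \<noteq> 0" "ray u y + ray v y = of_real (1 + 0) *\<^sub>C y" by auto
  from ray_sum_eigenvalue[OF u v this] uv show False by simp
qed

text \<open>Two orthogonal rays are linked through the ray of \<open>(u + v) / \<surd>2\<close>, so one ray sent to zero means that
  all rays are; additivity along the basis then sends the identity to zero.\<close>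

lemma image_ray_nonzero:
  assumes u: "norm u = 1"
  shows "\<phi> (ray u) \<noteq> (\<lambda>x. 0)"
proof
  assume zero: "\<phi> (ray u) = (\<lambda>x. 0)"
  have all: "\<phi> (ray v) = (\<lambda>x. 0)" if v: "norm v = 1" for v
  proof (cases "cinner u v = 0")
    case False
    then show ?thesis using image_ray_zero_spreads[OF u v _ zero] by simp
  next
    case True
    define w where "w = (1 / sqrt 2) *\<^sub>R (u + v)"
    have "inner u v = 0" using True by (metis Re_cinner zero_complex.sel(1))
    then have "norm (u + v) = sqrt 2"
      using norm_add_Pythagorean[of u v] u v by (simp add: orthogonal_def real_sqrt_unique)
    then have w: "norm w = 1" by (simp add: w_def)
    have vu: "cinner v u = 0" using True cinner_commute[of v u] by simp
    have uw: "cinner u w \<noteq> 0" and wv: "cinner w v \<noteq> 0"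
      using True vu u v
      by (simp_all add: w_def scaleC_of_real[symmetric] cinner_scaleC_left cinner_scaleC_right
          cinner_add_left cinner_add_right cinner_self del: of_real_divide)
    show ?thesis
      using image_ray_zero_spreads[OF w v wv image_ray_zero_spreads[OF u w uw zero]] .
  qed
  have partial: "(\<lambda>x. \<Sum>b\<in>S. ray b x) \<in> projections \<and> \<phi> (\<lambda>x. \<Sum>b\<in>S. ray b x) = (\<lambda>x. 0)"
    if "S \<subseteq> B" for S
    using finite_subset[OF that finite_basis] that
  proof (induction S rule: finite_induct)
    case empty
    then show ?case using zero_projection image_zero by simp
  next
    case (insert b S)
    have b: "ray b \<in> projections" using insert.prems norm_basis ray_projection by blast
    have "ray b (\<Sum>c\<in>S. ray c x) = 0" for x
      using insert.hyps insert.prems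
      by (auto simp: ray_def cinner_sum_left cinner_scaleC_left cinner_basis subset_iff
          intro!: sum.neutral)
    then have orth: "\<forall>x. ray b (\<Sum>c\<in>S. ray c x) = 0" by blast
    have IH: "(\<lambda>x. \<Sum>b\<in>S. ray b x) \<in> projections" "\<phi> (\<lambda>x. \<Sum>b\<in>S. ray b x) = (\<lambda>x. 0)"
      using insert by auto
    show ?case
      using projection_add[OF b IH(1) orth] image_add[OF b IH(1) orth] IH(2) all[of b]
        insert.hyps insert.prems norm_basis by (auto simp: fun_eq_iff)
  qed
  have "(\<lambda>x::'h. \<Sum>b\<in>B. ray b x) = (\<lambda>x. x)"
    by (simp add: ray_def basis_expansion)
  then have "(\<lambda>x::'h. x) = (\<lambda>x. 0)" using partial[of B] image_id by simp
  then have "u = 0" by metis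
  then show False using u by simp
qed

text \<open>Complete the unit vector to an orthonormal basis. The images of the \<open>n\<close> corresponding rays are
  pairwise orthogonal and nonzero, which leaves dimension one for each.\<close>

lemma image_ray:
  assumes u: "norm u = 1"
  shows "\<exists>v. norm v = 1 \<and> \<phi> (ray u) = ray v"
proof -
  have "orthonormal {u}" using u by (simp add: orthonormal_def cinner_self)
  then obtain C where C: "u \<in> C" "orthonormal_basis C"
    using orthonormal_extends_to_basis[OF finite_basis spanning, of "{u}"] by auto
  interpret C: orthonormal_basis C by fact
  have "\<exists>w. norm w = 1 \<and> \<phi> (ray b) w = w" if b: "b \<in> C" for b
  proof -
    note p = projectionD[OF into[OF ray_projection[OF C.norm_basis[OF b]]]]
    obtain x where x: "\<phi> (ray b) x \<noteq> 0"
      using image_ray_nonzero[OF C.norm_basis[OF b]] by (auto simp: fun_eq_iff)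
    define c where "c = complex_of_real (1 / norm (\<phi> (ray b) x))"
    have "norm (c *\<^sub>C \<phi> (ray b) x) = 1" using x by (simp add: c_def norm_divide)
    moreover have "\<phi> (ray b) (c *\<^sub>C \<phi> (ray b) x) = c *\<^sub>C \<phi> (ray b) x" by (simp add: p)
    ultimately show ?thesis by blast
  qed
  then obtain w where w: "\<And>b. b \<in> C \<Longrightarrow> norm (w b) = 1" "\<And>b. b \<in> C \<Longrightarrow> \<phi> (ray b) (w b) = w b"
    by metis
  have off: "\<phi> (ray b) (w c) = 0" if "b \<in> C" "c \<in> C" "b \<noteq> c" for b c
  proof -
    have "\<forall>x. ray b (ray c x) = 0"
      using that by (simp add: ray_def cinner_scaleC_left C.cinner_basis)
    from image_orthogonal[OF ray_projection[OF C.norm_basis] ray_projection[OF C.norm_basis] this,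
        of "w c"] that w(2)[of c] show ?thesis by simp
  qed
  have "cinner (w b) (w c) = (if b = c then 1 else 0)" if "b \<in> C" "c \<in> C" for b c
  proof (cases "b = c")
    case True
    then show ?thesis using w(1) that by (simp add: cinner_self)
  next
    case False
    have "cinner (w b) (w c) = cinner (w b) (\<phi> (ray b) (w c))"
      using projectionD(3)[OF into[OF ray_projection[OF C.norm_basis[OF that(1)]]], of "w b" "w c"]
        w(2)[OF that(1)] by simp
    then show ?thesis using off[OF that False] False by simp
  qed
  note expand = C.orthonormal_family_expansion[of w, OF this]
  note p = projectionD[OF into[OF ray_projection[OF u]]]
  have "\<phi> (ray u) x = ray (w u) x" for x
  proof -
    have "\<phi> (ray u) (\<Sum>b\<in>S. f b *\<^sub>C w b) = (\<Sum>b\<in>S. f b *\<^sub>C \<phi> (ray u) (w b))" for f S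
      by (induction S rule: infinite_finite_induct) (auto simp: p)
    then have "\<phi> (ray u) x = (\<Sum>b\<in>C. cinner x (w b) *\<^sub>C \<phi> (ray u) (w b))"
      by (metis expand)
    also have "\<dots> = (\<Sum>b\<in>C. if b = u then ray (w u) x else 0)"
      using off C(1) w(2) by (intro sum.cong) (auto simp: ray_def)
    finally show ?thesis using C(1) C.finite_basis by simp
  qed
  then show ?thesis using w(1)[OF C(1)] by auto
qed

text \<open>The sum of the image rays has the eigenvalue \<open>1 + \<bar>\<langle>u', v'\<rangle>\<bar>\<close>, which must be one of the numbers
  \<open>1 \<plusminus> \<bar>\<langle>u, v\<rangle>\<bar>\<close>.\<close>

lemma image_ray_transition:
  assumes u: "norm u = 1" "norm u' = 1" "\<phi> (ray u) = ray u'"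
    and v: "norm v = 1" "norm v' = 1" "\<phi> (ray v) = ray v'"
  shows "cmod (cinner u' v') = cmod (cinner u v)"
proof -
  obtain x where x: "x \<noteq> 0" "ray u' x + ray v' x = of_real (1 + cmod (cinner u' v')) *\<^sub>C x"
    using ray_sum_eigenvector[OF u(2) v(2)] by blast
  have "\<exists>y. y \<noteq> 0 \<and> ray u y + ray v y = of_real (1 + cmod (cinner u' v')) *\<^sub>C y"
    by (rule eigenvalue_of_sum[OF ray_projection[OF u(1)] ray_projection[OF v(1)] x(1)])
      (use x(2) u(3) v(3) in simp)
  then obtain y where y: "y \<noteq> 0" "ray u y + ray v y = of_real (1 + cmod (cinner u' v')) *\<^sub>C y"
    by blast
  have "1 + cmod (cinner u' v') \<noteq> 0"
    using norm_ge_zero[of "cinner u' v'"] by linarith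
  from ray_sum_eigenvalue[OF u(1) v(1) y this] show ?thesis by simp
qed

end

section \<open>Wigner's theorem in finite dimension\<close>

lemma Re_eq_if_cmod_eq:
  assumes "cmod z = cmod w" "cmod (1 + z) = cmod (1 + w)"
  shows "Re z = Re w"
proof -
  have "(cmod z)\<^sup>2 = (cmod w)\<^sup>2" "(cmod (1 + z))\<^sup>2 = (cmod (1 + w))\<^sup>2"
    using assms by simp_all
  then show ?thesis unfolding cmod_power2 by (simp add: power2_eq_square algebra_simps)
qed

lemma Im_mult_eq_if_cmod_eq:
  assumes "cmod z = cmod z'" "cmod w = cmod w'" "Re z = Re z'" "Re w = Re w'"
    and "cmod (1 + z + w) = cmod (1 + z' + w')"
  shows "Im z * Im w = Im z' * Im w'"
proof -
  have "(cmod z)\<^sup>2 = (cmod z')\<^sup>2" "(cmod w)\<^sup>2 = (cmod w')\<^sup>2"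
    "(cmod (1 + z + w))\<^sup>2 = (cmod (1 + z' + w'))\<^sup>2"
    using assms by simp_all
  then show ?thesis using assms(3,4)
    unfolding cmod_power2 by (simp add: power2_eq_square algebra_simps)
qed

lemma cmod_one_add_ii:
  assumes "cmod (1 + \<i> * w) = cmod (1 - \<i> * w)" shows "Im w = 0"
proof -
  have "(cmod (1 + \<i> * w))\<^sup>2 = (cmod (1 - \<i> * w))\<^sup>2" using assms by simp
  then show ?thesis unfolding cmod_power2 by (simp add: power2_eq_square algebra_simps)
qed

context orthonormal_basis
begin

text \<open>With \<open>\<sigma> = id\<close> this is the linear, with \<open>\<sigma> = cnj\<close> the conjugate-linear map sending each basis vector
  \<open>b\<close> to \<open>u b\<close>; the parameter \<open>\<sigma>\<close> lets both alternatives of Wigner's theorem share their proofs.\<close>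

definition semilinear_map :: "(complex \<Rightarrow> complex) \<Rightarrow> ('h \<Rightarrow> 'h) \<Rightarrow> 'h \<Rightarrow> 'h"
  where "semilinear_map \<sigma> u x = (\<Sum>b\<in>B. \<sigma> (cinner x b) *\<^sub>C u b)"

end

locale semilinear_isometry = orthonormal_basis B for B :: "'h::complex_hilbert set" +
  fixes \<sigma> :: "complex \<Rightarrow> complex" and u :: "'h \<Rightarrow> 'h"
  assumes conj: "\<sigma> \<in> {id, cnj}"
    and family: "b \<in> B \<Longrightarrow> c \<in> B \<Longrightarrow> cinner (u b) (u c) = (if b = c then 1 else 0)"
begin

abbreviation "V \<equiv> semilinear_map \<sigma> u"

lemma conj_simps [simp]: "\<sigma> (z + w) = \<sigma> z + \<sigma> w" "\<sigma> (z * w) = \<sigma> z * \<sigma> w" "cmod (\<sigma> z) = cmod z"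
  "\<sigma> 0 = 0" "\<sigma> 1 = 1" "\<sigma> (\<sigma> z) = z" "\<sigma> (cnj z) = cnj (\<sigma> z)"
  using conj by auto

lemma conj_sum: "\<sigma> (\<Sum>i\<in>I. f i) = (\<Sum>i\<in>I. \<sigma> (f i))"
  by (induction I rule: infinite_finite_induct) auto

lemma cinner_family_combination: "b \<in> B \<Longrightarrow> cinner (\<Sum>c\<in>B. f c *\<^sub>C u c) (u b) = f b"
  using finite_basis by (simp add: cinner_sum_left cinner_scaleC_left family if_distrib sum.delta cong: if_cong)

lemma coordinate: "b \<in> B \<Longrightarrow> cinner (V x) (u b) = \<sigma> (cinner x b)"
  unfolding semilinear_map_def by (rule cinner_family_combination)

lemma eqI:
  assumes "\<And>b. b \<in> B \<Longrightarrow> cinner y (u b) = \<sigma> (cinner x b)" shows "y = V x"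
proof -
  have "y = (\<Sum>b\<in>B. cinner y (u b) *\<^sub>C u b)"
    using orthonormal_family_expansion[of u y] family by simp
  also have "\<dots> = V x" unfolding semilinear_map_def using assms by (intro sum.cong) auto
  finally show ?thesis .
qed

lemma add: "V (x + y) = V x + V y"
  by (simp add: semilinear_map_def cinner_add_left scaleC_add_left sum.distrib)

lemma scale: "V (c *\<^sub>C x) = \<sigma> c *\<^sub>C V x"
  by (simp add: semilinear_map_def cinner_scaleC_left complex_vector.scale_sum_right scaleC_scaleC)

lemma basis_image: "b \<in> B \<Longrightarrow> V b = u b"
  by (rule eqI[symmetric]) (simp add: family cinner_basis)

lemma cinner_image: "cinner (V x) (V y) = \<sigma> (cinner x y)"
proof -
  have "cinner (V x) (V y) = (\<Sum>b\<in>B. cnj (\<sigma> (cinner y b)) * cinner (V x) (u b))"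
    by (subst (2) semilinear_map_def) (simp add: cinner_sum_right cinner_scaleC_right)
  also have "\<dots> = \<sigma> (\<Sum>b\<in>B. cnj (cinner y b) * cinner x b)"
    unfolding conj_sum by (intro sum.cong) (simp_all add: coordinate)
  also have "(\<Sum>b\<in>B. cnj (cinner y b) * cinner x b) = cinner x y"
    using arg_cong[OF basis_expansion[of y], of "cinner x"]
    by (simp add: cinner_sum_right cinner_scaleC_right)
  finally show ?thesis .
qed

lemma norm_image: "norm (V x) = norm x"
proof -
  have "cmod (cinner (V x) (V x)) = cmod (cinner x x)" by (simp add: cinner_image)
  then show ?thesis by (simp add: cinner_self norm_power)
qed

lemma surjective: "V (\<Sum>b\<in>B. \<sigma> (cinner y (u b)) *\<^sub>C b) = y"
proof (rule eqI[symmetric])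
  fix b assume "b \<in> B"
  then show "cinner y (u b) = \<sigma> (cinner (\<Sum>b\<in>B. \<sigma> (cinner y (u b)) *\<^sub>C b) b)"
    using finite_basis
    by (simp add: cinner_sum_left cinner_scaleC_left cinner_basis if_distrib sum.delta cong: if_cong)
qed

end

context orthonormal_basis
begin

text \<open>
  Scale \<open>x\<close> and its image so that both have coordinate \<open>1\<close> at \<open>b0\<close> and \<open>u b0\<close>. Each further coordinate keeps
  its modulus, and comparison with \<open>b0 + b\<close> also preserves its real part, so it is preserved or
  conjugated. In particular real coordinates are kept. Comparison with the real vector
  \<open>b0 + b + c\<close> preserves the products of the imaginary parts, so all coordinates of \<open>x\<close> are preserved or
  all are conjugated. Finally the choice does not depend on \<open>x\<close>, and the excluded vectors orthogonal to \<open>b0\<close>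
  are reached through \<open>b0 + x\<close>.
\<close>

lemma wigner_normalised:
  fixes F u :: "'h \<Rightarrow> 'h"
  assumes family: "\<And>b c. b \<in> B \<Longrightarrow> c \<in> B \<Longrightarrow> cinner (u b) (u c) = (if b = c then 1 else 0)"
    and b0: "b0 \<in> B"
    and F: "\<And>x y. cmod (cinner (F x) (F y)) = cmod (cinner x y)"
    and F1: "\<And>x b. b \<in> B \<Longrightarrow> cmod (cinner (F x) (u b)) = cmod (cinner x b)"
    and F2: "\<And>x b. b \<in> B \<Longrightarrow> b \<noteq> b0 \<Longrightarrow> cmod (cinner (F x) (u b0 + u b)) = cmod (cinner x (b0 + b))"
  shows "\<exists>\<sigma>\<in>{id, cnj}. \<forall>x. \<exists>c. cmod c = 1 \<and> F x = c *\<^sub>C semilinear_map \<sigma> u x"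
proof -
  interpret L: semilinear_isometry B id u by unfold_locales (use family in auto)
  interpret C: semilinear_isometry B cnj u by unfold_locales (use family in auto)
  define A where "A = {x. cinner x b0 = 1}"
  \<comment> \<open>\<open>G x\<close> is the multiple of \<open>F x\<close> whose coordinate at \<open>u b0\<close> is \<open>1\<close>.\<close>
  define G where "G x = inverse (cinner (F x) (u b0)) *\<^sub>C F x" for x
  have unit: "cmod (cinner (F x) (u b0)) = 1" if "x \<in> A" for x
    using F1[OF b0, of x] that by (simp add: A_def)
  have G0: "cinner (G x) (u b0) = 1" if "x \<in> A" for x
    using unit[OF that] by (simp add: G_def cinner_scaleC_left) (metis left_inverse norm_zero zero_neq_one)
  have GL: "cmod (cinner (G x) z) = cmod (cinner (F x) z)" if "x \<in> A" for x z
    using unit[OF that] by (simp add: G_def cinner_scaleC_left norm_mult norm_inverse)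
  have GR: "cmod (cinner z (G x)) = cmod (cinner z (F x))" if "x \<in> A" for x z
    using unit[OF that] by (simp add: G_def cinner_scaleC_right norm_mult norm_inverse)
  have G: "cmod (cinner (G x) (G y)) = cmod (cinner x y)" if "x \<in> A" "y \<in> A" for x y
    using that by (simp add: GL GR F)
  have coord_mod: "cmod (cinner (G x) (u b)) = cmod (cinner x b)" if "x \<in> A" "b \<in> B" for x b
    using that by (simp add: GL F1)
  have coord_Re: "Re (cinner (G x) (u b)) = Re (cinner x b)" if x: "x \<in> A" and b: "b \<in> B" for x b
  proof (cases "b = b0")
    case True
    then show ?thesis using G0[OF x] x by (simp add: A_def)
  next
    case False
    have "cmod (1 + cinner (G x) (u b)) = cmod (cinner (G x) (u b0 + u b))"
      by (simp add: cinner_add_right G0[OF x])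
    also have "\<dots> = cmod (cinner (F x) (u b0 + u b))" by (rule GL[OF x])
    also have "\<dots> = cmod (1 + cinner x b)"
      using F2[OF b False, of x] x by (simp add: cinner_add_right A_def)
    finally show ?thesis by (rule Re_eq_if_cmod_eq[OF coord_mod[OF x b]])
  qed
  have Im_sq: "Im (cinner (G x) (u b)) * Im (cinner (G x) (u b)) = Im (cinner x b) * Im (cinner x b)"
    if "x \<in> A" "b \<in> B" for x b
  proof -
    have "(cmod (cinner (G x) (u b)))\<^sup>2 = (cmod (cinner x b))\<^sup>2" using coord_mod[OF that] by simp
    then show ?thesis using coord_Re[OF that]
      unfolding cmod_power2 by (simp add: power2_eq_square)
  qed
  have real: "G x = L.V x" if "x \<in> A" "\<forall>b\<in>B. Im (cinner x b) = 0" for x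
  proof (rule L.eqI)
    fix b assume "b \<in> B"
    then show "cinner (G x) (u b) = id (cinner x b)"
      using that coord_Re[of x b] Im_sq[of x b] by (simp add: complex_eq_iff)
  qed
  have Im_mult: "Im (cinner (G x) (u b)) * Im (cinner (G x) (u c)) = Im (cinner x b) * Im (cinner x c)"
    if x: "x \<in> A" and bc: "b \<in> B" "c \<in> B" for x b c
  proof -
    consider "b = b0" | "c = b0" | "b = c" | "b \<noteq> b0" "c \<noteq> b0" "b \<noteq> c" by blast
    then show ?thesis
    proof cases
      case 4
      define y where "y = b0 + b + c"
      have y: "y \<in> A" using 4 bc b0 by (simp add: y_def A_def cinner_add_left cinner_basis)
      have "G y = L.V y"
        by (rule real[OF y]) (use bc b0 in \<open>auto simp: y_def cinner_add_left cinner_basis\<close>)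
      also have "\<dots> = u b0 + u b + u c"
        by (simp add: y_def L.add L.basis_image b0 bc)
      finally have "cmod (1 + cinner (G x) (u b) + cinner (G x) (u c)) = cmod (cinner (G x) (G y))"
        by (simp add: cinner_add_right G0[OF x])
      also have "\<dots> = cmod (1 + cinner x b + cinner x c)"
        unfolding G[OF x y] using x by (simp add: y_def cinner_add_right A_def)
      finally show ?thesis
        using Im_mult_eq_if_cmod_eq coord_mod[OF x] coord_Re[OF x] bc by meson
    qed (use x b0 bc G0[OF x] Im_sq[OF x] in \<open>auto simp: A_def\<close>)
  qed
  have dichotomy: "G x = L.V x \<or> G x = C.V x" if x: "x \<in> A" for x
  proof (cases "\<forall>b\<in>B. Im (cinner x b) = 0")
    case True
    then show ?thesis using real[OF x] by simp
  next
    case False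
    then obtain j where j: "j \<in> B" "Im (cinner x j) \<noteq> 0" by blast
    from Im_sq[OF x j(1)]
    consider "Im (cinner (G x) (u j)) = Im (cinner x j)" | "Im (cinner (G x) (u j)) = - Im (cinner x j)"
      by (metis power2_eq_iff power2_eq_square)
    then show ?thesis
    proof cases
      case 1
      have "G x = L.V x"
        using Im_mult[OF x _ j(1)] coord_Re[OF x] j(2) 1
        by (intro L.eqI) (simp add: complex_eq_iff)
      then show ?thesis ..
    next
      case 2
      have "G x = C.V x"
      proof (rule C.eqI)
        fix b assume b: "b \<in> B"
        have "- Im (cinner (G x) (u b)) * Im (cinner x j) = Im (cinner x b) * Im (cinner x j)"
          using Im_mult[OF x b j(1)] 2 by simp
        then have "- Im (cinner (G x) (u b)) = Im (cinner x b)"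
          using j(2) by (metis mult_right_cancel)
        then have "Im (cinner (G x) (u b)) = - Im (cinner x b)" by linarith
        then show "cinner (G x) (u b) = cnj (cinner x b)"
          using coord_Re[OF x b] by (simp add: complex_eq_iff)
      qed
      then show ?thesis ..
    qed
  qed
  have LC: "L.V x = C.V x" if "\<forall>b\<in>B. Im (cinner x b) = 0" for x
    by (rule C.eqI) (use that in \<open>simp add: L.coordinate complex_eq_iff\<close>)
  have coherent: "(\<forall>x\<in>A. G x = L.V x) \<or> (\<forall>x\<in>A. G x = C.V x)"
  proof (rule ccontr)
    assume "\<not> ?thesis"
    then obtain x y where x: "x \<in> A" "G x \<noteq> L.V x" and y: "y \<in> A" "G y \<noteq> C.V y" by blast
    have Gx: "G x = C.V x" and Gy: "G y = L.V y" using dichotomy x y by auto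
    obtain j where j: "j \<in> B" "Im (cinner x j) \<noteq> 0" using real x by blast
    have "\<not> (\<forall>b\<in>B. Im (cinner y b) = 0)" using real[OF y(1)] LC y(2) by metis
    then obtain k where k: "k \<in> B" "Im (cinner y k) \<noteq> 0" by blast
    \<comment> \<open>Whether \<open>G\<close> is linear or conjugate-linear at the test vector \<open>b0 + \<i> s\<close>, one of \<open>x\<close> and \<open>y\<close>
      disagrees with it, and the transition probability then forces that vector to be real at \<open>s\<close>.\<close>
    have test: "Im (cinner x s) = 0 \<or> Im (cinner y s) = 0"
      if s: "cinner s b0 = 0" "\<forall>b\<in>B. Im (cinner s b) = 0" for s
    proof -
      define z z' where "z = b0 + \<i> *\<^sub>C s" and "z' = b0 - \<i> *\<^sub>C s"
      have z: "z \<in> A"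
        using s b0 by (simp add: A_def z_def cinner_add_left cinner_scaleC_left cinner_basis)
      have cnj: "cnj (cinner s b) = cinner s b" if "b \<in> B" for b
        using s(2) that by (simp add: complex_eq_iff)
      have b0b: "cinner b0 b = (if b0 = b then 1 else 0)" if "b \<in> B" for b
        using that b0 by (rule cinner_basis[rotated])
      have LCz: "L.V z = C.V z'"
        by (rule C.eqI) (simp add: L.coordinate z_def z'_def cinner_add_left cinner_diff_left cinner_scaleC_left b0b cnj)
      have CLz: "C.V z = L.V z'"
        by (rule L.eqI) (simp add: C.coordinate z_def z'_def cinner_add_left cinner_diff_left cinner_scaleC_left b0b cnj)
      have at: "cinner w z = 1 - \<i> * cinner w s" "cinner w z' = 1 + \<i> * cinner w s" if "w \<in> A" for w
        using that by (simp_all add: A_def z_def z'_def cinner_add_right cinner_diff_right cinner_scaleC_right)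
      from dichotomy[OF z] show ?thesis
      proof
        assume "G z = L.V z"
        then have "cmod (cinner x z') = cmod (cinner x z)"
          using G[OF x(1) z] by (simp add: Gx LCz C.cinner_image)
        then show ?thesis using cmod_one_add_ii at[OF x(1)] by simp
      next
        assume "G z = C.V z"
        then have "cmod (cinner y z') = cmod (cinner y z)"
          using G[OF y(1) z] by (simp add: Gy CLz L.cinner_image)
        then show ?thesis using cmod_one_add_ii at[OF y(1)] by simp
      qed
    qed
    have j0: "j \<noteq> b0" and k0: "k \<noteq> b0" using j k x(1) y(1) by (auto simp: A_def)
    have "Im (cinner y j) = 0" using test[of j] j b0 j0 by (simp add: cinner_basis)
    moreover have "Im (cinner x k) = 0" using test[of k] k b0 k0 by (simp add: cinner_basis)
    moreover have "Im (cinner x (j + k)) = 0 \<or> Im (cinner y (j + k)) = 0"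
      by (rule test) (use j k b0 j0 k0 in \<open>auto simp: cinner_basis cinner_add_left\<close>)
    ultimately show False using j(2) k(2) by (simp add: cinner_add_right)
  qed
  have "\<forall>x. \<exists>c. cmod c = 1 \<and> F x = c *\<^sub>C semilinear_map \<sigma> u x"
    if \<sigma>: "\<sigma> \<in> {id, cnj}" and K: "\<forall>x\<in>A. G x = semilinear_map \<sigma> u x" for \<sigma>
  proof
    interpret S: semilinear_isometry B \<sigma> u by unfold_locales (use \<sigma> family in auto)
    fix x
    have test: "cmod (cinner (F x) (S.V y)) = cmod (cinner x y)" if "y \<in> A" for y
      using K that GR[OF that] F by metis
    have "cmod (cinner (F x) (S.V x)) = norm x * norm x"
    proof (cases "cinner x b0 = 0")
      case False
      define t where "t = inverse (cinner x b0)"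
      have t: "t \<noteq> 0" using False by (simp add: t_def)
      have "t *\<^sub>C x \<in> A" using False by (simp add: A_def t_def cinner_scaleC_left)
      from test[OF this] t show ?thesis
        by (simp add: S.scale cinner_scaleC_right norm_mult cinner_self norm_power power2_eq_square)
    next
      case True
      have "b0 + x \<in> A" using True b0 by (simp add: A_def cinner_add_left cinner_basis)
      moreover have "cinner (F x) (u b0) = 0" using F1[OF b0, of x] True by simp
      ultimately show ?thesis
        using test[of "b0 + x"] True
        by (simp add: S.add S.basis_image b0 cinner_add_right cinner_self norm_mult power2_eq_square)
    qed
    moreover have "norm (F x) = norm x"
      using F[of x x] by (simp add: cinner_self norm_power)
    ultimately show "\<exists>c. cmod c = 1 \<and> F x = c *\<^sub>C S.V x"
      by (intro parallel_if_cauchy_schwarz_sharp) (simp_all add: S.norm_image)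
  qed
  then show ?thesis using coherent by blast
qed

text \<open>The images of the basis vectors are orthonormal, and their phases can be chosen such that
  \<open>F (b0 + b)\<close> is a multiple of \<open>u b0 + u b\<close>, which is the normalisation needed above.\<close>

theorem wigner:
  fixes F :: "'h \<Rightarrow> 'h"
  assumes b0: "b0 \<in> B"
    and F: "\<And>x y. cmod (cinner (F x) (F y)) = cmod (cinner x y)"
  shows "\<exists>\<sigma> u. semilinear_isometry B \<sigma> u \<and> (\<forall>x. \<exists>c. cmod c = 1 \<and> F x = c *\<^sub>C semilinear_map \<sigma> u x)"
proof -
  have FB: "cinner (F b) (F c) = (if b = c then 1 else 0)" if "b \<in> B" "c \<in> B" for b c
  proof (cases "b = c")
    case True
    have "norm (F b) = norm b" using F[of b b] by (simp add: cinner_self norm_power)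
    then show ?thesis using norm_basis[OF that(1)] True by (simp add: cinner_self)
  next
    case False
    then show ?thesis using F[of b c] cinner_basis[OF that] by simp
  qed
  define \<theta> where "\<theta> b = (if b = b0 then 1 else
    cinner (F (b0 + b)) (F b) / cinner (F (b0 + b)) (F b0))" for b
  define u where "u b = \<theta> b *\<^sub>C F b" for b
  have mod: "cmod (cinner (F (b0 + b)) (F c)) = (if c = b0 \<or> c = b then 1 else 0)"
    if "b \<in> B" "b \<noteq> b0" "c \<in> B" for b c
    using F[of "b0 + b" c] that b0 by (simp add: cinner_add_left cinner_basis)
  have \<theta>: "cmod (\<theta> b) = 1" if "b \<in> B" for b
    using mod[OF that _ b0] mod[OF that _ that] by (simp add: \<theta>_def norm_divide)
  have family: "cinner (u b) (u c) = (if b = c then 1 else 0)" if "b \<in> B" "c \<in> B" for b c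
  proof -
    have "\<theta> b * cnj (\<theta> b) = 1" "cnj (\<theta> b) * \<theta> b = 1"
      using \<theta>[OF that(1)] by (metis complex_norm_square mult.commute of_real_1 power_one)+
    then show ?thesis
      using FB[OF that] by (auto simp: u_def cinner_scaleC_left cinner_scaleC_right mult.commute)
  qed
  have u0: "u b0 = F b0" by (simp add: u_def \<theta>_def)
  have F1: "cmod (cinner (F x) (u b)) = cmod (cinner x b)" if "b \<in> B" for x b
    using F[of x b] \<theta>[OF that] by (simp add: u_def cinner_scaleC_right norm_mult)
  have F2: "cmod (cinner (F x) (u b0 + u b)) = cmod (cinner x (b0 + b))"
    if b: "b \<in> B" "b \<noteq> b0" for x b
  proof -
    define y where "y = F (b0 + b)"
    define a where "a = cinner y (F b0)"
    have a: "cmod a = 1" using mod[OF b b0] by (simp add: a_def y_def)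
    then have a0: "cinner (F (b0 + b)) (F b0) \<noteq> 0" by (auto simp: a_def y_def)
    have "(\<Sum>c\<in>B. cinner y (F c) *\<^sub>C F c) = y"
      by (rule orthonormal_family_expansion) (rule FB)
    have zero: "cinner y (F c) = 0" if "c \<in> B" "c \<noteq> b0" "c \<noteq> b" for c
      using mod[OF b that(1)] that by (simp add: y_def)
    note \<open>(\<Sum>c\<in>B. cinner y (F c) *\<^sub>C F c) = y\<close>[symmetric]
    also have "(\<Sum>c\<in>B. cinner y (F c) *\<^sub>C F c) = (\<Sum>c\<in>{b0, b}. cinner y (F c) *\<^sub>C F c)"
      using finite_basis b b0 zero by (intro sum.mono_neutral_right) auto
    finally have "y = a *\<^sub>C (u b0 + u b)"
      using b(2) a0 by (simp add: u0 a_def y_def u_def \<theta>_def scaleC_add_right scaleC_scaleC)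
    then have "cmod (cinner (F x) (u b0 + u b)) = cmod (cinner (F x) y)"
      using a by (simp add: cinner_scaleC_right norm_mult)
    then show ?thesis by (simp add: y_def F)
  qed
  obtain \<sigma> where \<sigma>: "\<sigma> \<in> {id, cnj}"
    "\<forall>x. \<exists>c. cmod c = 1 \<and> F x = c *\<^sub>C semilinear_map \<sigma> u x"
    using wigner_normalised[OF family b0 F F1 F2] by blast
  have "semilinear_isometry B \<sigma> u" by unfold_locales (use \<sigma>(1) family in auto)
  then show ?thesis using \<sigma>(2) by blast
qed

end

section \<open>From rays to all projections\<close>

lemma ray_phase:
  assumes "cmod c = 1" shows "ray (c *\<^sub>C v) = ray (v::'h::complex_inner)"
proof -
  have "cnj c * c = 1" using assms by (metis complex_norm_square mult.commute of_real_1 power_one)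
  then show ?thesis
    by (simp add: ray_def fun_eq_iff cinner_scaleC_right scaleC_scaleC mult.commute mult.left_commute)
qed

context spectrum_shrinking
begin

text \<open>Unit vectors spanning the image rays, extended homogeneously, give a map \<open>F\<close> on vectors to which
  Wigner's theorem applies.\<close>

theorem intertwined_by_semilinear_isometry:
  assumes b0: "b0 \<in> B"
  shows "\<exists>\<sigma> u. semilinear_isometry B \<sigma> u \<and>
    (\<forall>P\<in>projections. \<forall>x. \<phi> P (semilinear_map \<sigma> u x) = semilinear_map \<sigma> u (P x))"
proof -
  obtain w where w: "\<And>v. norm v = 1 \<Longrightarrow> norm (w v) = 1" "\<And>v. norm v = 1 \<Longrightarrow> \<phi> (ray v) = ray (w v)"
    using image_ray by metis
  define e where "e x = complex_of_real (1 / norm x) *\<^sub>C x" for x :: 'h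
  define F where "F x = complex_of_real (norm x) *\<^sub>C w (e x)" for x
  have e: "norm (e x) = 1" if "x \<noteq> 0" for x using that by (simp add: e_def norm_divide)
  have x_e: "x = complex_of_real (norm x) *\<^sub>C e x" for x
    by (cases "x = 0") (simp_all add: e_def scaleC_scaleC)
  have "cmod (cinner (F x) (F y)) = cmod (cinner x y)" for x y
  proof (cases "x = 0 \<or> y = 0")
    case True
    then show ?thesis by (auto simp: F_def)
  next
    case False
    have "cmod (cinner (F x) (F y)) = norm x * norm y * cmod (cinner (w (e x)) (w (e y)))"
      by (simp add: F_def cinner_scaleC_left cinner_scaleC_right norm_mult)
    also have "cmod (cinner (w (e x)) (w (e y))) = cmod (cinner (e x) (e y))"
      using image_ray_transition e w False by blast
    also have "norm x * norm y * \<dots> = cmod (cinner x y)"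
      by (subst (3) x_e, subst (5) x_e) (simp add: cinner_scaleC_left cinner_scaleC_right norm_mult)
    finally show ?thesis .
  qed
  from wigner[OF b0 this] obtain \<sigma> u where S: "semilinear_isometry B \<sigma> u"
    and Fu: "\<And>x. \<exists>c. cmod c = 1 \<and> F x = c *\<^sub>C semilinear_map \<sigma> u x" by blast
  interpret S: semilinear_isometry B \<sigma> u by (rule S)
  have ray_image: "\<phi> (ray v) = ray (S.V v)" if v: "norm v = 1" for v
  proof -
    have "F v = w v" using v by (simp add: F_def e_def)
    then show ?thesis using w(2)[OF v] Fu[of v] ray_phase by metis
  qed
  \<comment> \<open>A unit vector in the kernel of \<open>P\<close> spans a ray orthogonal to \<open>P\<close>.\<close>
  have kernel: "\<phi> P (S.V x) = 0" if P: "P \<in> projections" and x: "P x = 0" for P x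
  proof (cases "x = 0")
    case True
    then show ?thesis using S.norm_image[of 0] projectionD(5)[OF into[OF P]] by simp
  next
    case False
    have "P (e x) = 0" by (simp add: e_def projectionD[OF P] x)
    then have orth: "\<forall>y. P (ray (e x) y) = 0" by (simp add: ray_def projectionD[OF P])
    have "\<phi> P (ray (S.V (e x)) (S.V (e x))) = 0"
      using image_orthogonal[OF P ray_projection[OF e[OF False]] orth] ray_image[OF e[OF False]] by metis
    then have "\<phi> P (S.V (e x)) = 0"
      by (simp add: ray_def cinner_self S.norm_image e[OF False])
    then show ?thesis
      by (subst x_e) (simp add: S.scale projectionD[OF into[OF P]])
  qed
  have "\<phi> P (S.V x) = S.V (P x)" if P: "P \<in> projections" for P x
  proof -
    have "\<phi> (\<lambda>x. x - P x) (S.V (P x)) = 0"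
      by (rule kernel[OF projection_diff_id[OF P]]) (simp add: projectionD[OF P])
    then have 1: "\<phi> P (S.V (P x)) = S.V (P x)"
      unfolding image_complement[OF P] by simp
    have 2: "\<phi> P (S.V (x - P x)) = 0"
      by (rule kernel[OF P]) (simp add: projectionD[OF P])
    have "S.V x = S.V (P x) + S.V (x - P x)" using S.add[of "P x" "x - P x"] by simp
    then show ?thesis by (simp add: projectionD[OF into[OF P]] 1 2)
  qed
  then show ?thesis using S by blast
qed

end

section \<open>Linear combinations and the joint spectrum\<close>

context orthonormal_basis
begin

lemma joint_spectrum_kernel:
  assumes "set As \<subseteq> (projections :: ('h \<Rightarrow> 'h) set)"
  shows "joint_spectrum As = {cs. length cs = length As \<and>
    (\<exists>x. x \<noteq> 0 \<and> (\<Sum>i<length As. (cs ! i) *\<^sub>C (As ! i) x) = 0)}"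
proof -
  have "(\<lambda>x. \<Sum>i<length As. (cs ! i) *\<^sub>C (As ! i) x) \<in> bounded_operators" for cs
    unfolding bounded_operators_iff
  proof (intro conjI allI)
    have p: "As ! i \<in> projections" if "i < length As" for i using assms that by auto
    fix x y c
    show "(\<Sum>i<length As. (cs ! i) *\<^sub>C (As ! i) (x + y)) =
        (\<Sum>i<length As. (cs ! i) *\<^sub>C (As ! i) x) + (\<Sum>i<length As. (cs ! i) *\<^sub>C (As ! i) y)"
      by (simp add: projectionD(1)[OF p] scaleC_add_right sum.distrib)
    show "(\<Sum>i<length As. (cs ! i) *\<^sub>C (As ! i) (c *\<^sub>C x)) = c *\<^sub>C (\<Sum>i<length As. (cs ! i) *\<^sub>C (As ! i) x)"
      by (simp add: projectionD(2)[OF p] complex_vector.scale_sum_right mult.commute)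
  qed
  then show ?thesis
    unfolding joint_spectrum_def by (auto simp: invertible_iff_injective)
qed

text \<open>Longer tuples are used with vanishing coefficients beyond the third.\<close>

lemma shrinks_joint_spectrum_triple:
  assumes k: "3 \<le> k" and "shrinks_joint_spectrum \<phi> k"
    and into: "\<forall>P\<in>projections. \<phi> P \<in> projections"
    and PQR: "P \<in> projections" "Q \<in> projections" "R \<in> projections"
    and x: "x \<noteq> 0" "a *\<^sub>C \<phi> P x + b *\<^sub>C \<phi> Q x + c *\<^sub>C \<phi> R x = (0::'h)"
  shows "\<exists>y. y \<noteq> 0 \<and> a *\<^sub>C P y + b *\<^sub>C Q y + c *\<^sub>C R y = 0"
proof -
  define cs where "cs = [a, b, c] @ replicate (k - 3) 0"
  have pad: "(\<Sum>i<k. (cs ! i) *\<^sub>C (([A, A', A''] @ replicate (k - 3) A) ! i) z) =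
      a *\<^sub>C A z + b *\<^sub>C A' z + c *\<^sub>C A'' z" for A A' A'' and z :: 'h
  proof -
    have "(\<Sum>i<k. (cs ! i) *\<^sub>C (([A, A', A''] @ replicate (k - 3) A) ! i) z) =
        (\<Sum>i<3. (cs ! i) *\<^sub>C (([A, A', A''] @ replicate (k - 3) A) ! i) z)"
      using k by (intro sum.mono_neutral_right) (auto simp: cs_def nth_append)
    then show ?thesis by (simp add: cs_def eval_nat_numeral)
  qed
  define Ps where "Ps = [P, Q, R] @ replicate (k - 3) P"
  have Ps: "length Ps = k" "set Ps \<subseteq> projections" "length cs = k"
    using k PQR by (auto simp: Ps_def cs_def)
  have map_Ps: "map \<phi> Ps = [\<phi> P, \<phi> Q, \<phi> R] @ replicate (k - 3) (\<phi> P)" by (simp add: Ps_def)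
  have "set (map \<phi> Ps) \<subseteq> projections" using Ps into by auto
  from joint_spectrum_kernel[OF this] have "cs \<in> joint_spectrum (map \<phi> Ps)"
    using x pad[of "\<phi> P" "\<phi> Q" "\<phi> R"] Ps unfolding map_Ps[symmetric] by auto
  then have "cs \<in> joint_spectrum Ps"
    using assms(2) Ps unfolding shrinks_joint_spectrum_def by blast
  then obtain y where y: "y \<noteq> 0" "(\<Sum>i<k. (cs ! i) *\<^sub>C (Ps ! i) y) = 0"
    unfolding joint_spectrum_kernel[OF Ps(2)] Ps(1) by blast
  have "a *\<^sub>C P y + b *\<^sub>C Q y + c *\<^sub>C R y = 0"
    using pad[of P Q R y, folded Ps_def] y(2) by simp
  then show ?thesis using y(1) by blast
qed

text \<open>Conjugating the coefficients gives the adjoint operator, and an operator and its adjoint are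
  singular together.\<close>

lemma conjugate_combination_kernel:
  assumes P: "\<And>i. i < k \<Longrightarrow> P i \<in> projections"
    and x: "x \<noteq> 0" "(\<Sum>i<k. c i *\<^sub>C P i x) = (0::'h)"
  shows "\<exists>y. y \<noteq> 0 \<and> (\<Sum>i<k. cnj (c i) *\<^sub>C P i y) = 0"
proof (rule ccontr)
  assume inj: "\<not> ?thesis"
  define T where "T y = (\<Sum>i<k. cnj (c i) *\<^sub>C P i y)" for y
  have "T \<in> bounded_operators"
    unfolding bounded_operators_iff T_def
    by (simp add: projectionD(1,2)[OF P] scaleC_add_right sum.distrib complex_vector.scale_sum_right
        mult.commute)
  moreover have "cadjoint T = (\<lambda>y. \<Sum>i<k. c i *\<^sub>C P i y)"
    by (rule cadjoint_eqI)
      (simp add: T_def cinner_sum_left cinner_sum_right cinner_scaleC_left cinner_scaleC_right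
        projectionD(3)[OF P])
  ultimately show False
    using cadjoint_injective[of T x] inj x by (auto simp: T_def)
qed

text \<open>Moving \<open>V\<close> out of a linear combination replaces its coefficients \<open>c\<close> by \<open>\<sigma> c\<close>.\<close>

lemma preserves_if_intertwined:
  fixes V :: "'h \<Rightarrow> 'h"
  assumes \<sigma>: "\<sigma> \<in> {id, cnj}"
    and V: "\<And>x y. V (x + y) = V x + V y" "\<And>c x. V (c *\<^sub>C x) = \<sigma> c *\<^sub>C V x" "bij V"
    and into: "\<forall>P\<in>projections. \<phi> P \<in> projections"
    and intertwined: "\<And>P x. P \<in> projections \<Longrightarrow> \<phi> P (V x) = V (P x)"
  shows "preserves_joint_spectrum \<phi> k"
  unfolding preserves_joint_spectrum_def
proof (intro allI impI)
  fix Ps :: "('h \<Rightarrow> 'h) list"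
  assume Ps: "length Ps = k \<and> set Ps \<subseteq> projections"
  then have p: "Ps ! i \<in> projections" if "i < k" for i using that by auto
  have \<phi>Ps: "set (map \<phi> Ps) \<subseteq> projections" using Ps into by auto
  have V0: "V 0 = 0" using V(1)[of 0 0] by simp
  have V_eq_0: "V x = 0 \<longleftrightarrow> x = 0" for x using V(3) V0 by (metis bij_pointE)
  have V_sum: "V (\<Sum>i\<in>I. f i) = (\<Sum>i\<in>I. V (f i))" for f and I :: "nat set"
    by (induction I rule: infinite_finite_induct) (auto simp: V0 V(1))
  have ex_V: "(\<exists>x. R x) \<longleftrightarrow> (\<exists>x. R (V x))" for R
    using bij_is_surj[OF V(3)] by (metis surjD)
  have \<sigma>\<sigma>: "\<sigma> (\<sigma> z) = z" for z using \<sigma> by auto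
  have comb: "(\<Sum>i<k. (cs ! i) *\<^sub>C (map \<phi> Ps ! i) (V x)) = V (\<Sum>i<k. \<sigma> (cs ! i) *\<^sub>C (Ps ! i) x)" for cs x
    unfolding V_sum using Ps p by (intro sum.cong) (auto simp: V(2) \<sigma>\<sigma> intertwined)
  have "(\<exists>x. x \<noteq> 0 \<and> (\<Sum>i<k. (cs ! i) *\<^sub>C (map \<phi> Ps ! i) x) = 0) \<longleftrightarrow>
      (\<exists>x. x \<noteq> 0 \<and> (\<Sum>i<k. (cs ! i) *\<^sub>C (Ps ! i) x) = 0)" (is "?L \<longleftrightarrow> ?R") for cs
  proof -
    have "?L \<longleftrightarrow> (\<exists>x. V x \<noteq> 0 \<and> (\<Sum>i<k. (cs ! i) *\<^sub>C (map \<phi> Ps ! i) (V x)) = 0)"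
      by (rule ex_V)
    also have "\<dots> \<longleftrightarrow> (\<exists>x. x \<noteq> 0 \<and> (\<Sum>i<k. \<sigma> (cs ! i) *\<^sub>C (Ps ! i) x) = 0)"
      unfolding comb V_eq_0 ..
    also have "\<dots> \<longleftrightarrow> ?R"
    proof (cases "\<sigma> = id")
      case False
      then have "\<sigma> = cnj" using \<sigma> by simp
      then show ?thesis
        using conjugate_combination_kernel[of k "\<lambda>i. Ps ! i" _ "\<lambda>i. cs ! i"]
          conjugate_combination_kernel[of k "\<lambda>i. Ps ! i" _ "\<lambda>i. cnj (cs ! i)"] p by auto
    qed simp
    finally show ?thesis .
  qed
  then show "joint_spectrum (map \<phi> Ps) = joint_spectrum Ps"
    using joint_spectrum_kernel[OF \<phi>Ps] joint_spectrum_kernel[of Ps] Ps by simp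
qed

end

context semilinear_isometry
begin

definition V_inv :: "'h \<Rightarrow> 'h"
  where "V_inv y = (\<Sum>b\<in>B. \<sigma> (cinner y (u b)) *\<^sub>C b)"

lemma V_V_inv: "V (V_inv y) = y"
  unfolding V_inv_def by (rule surjective)

lemma V_inv_V: "V_inv (V x) = x"
proof -
  have "V_inv (V x) = (\<Sum>b\<in>B. cinner x b *\<^sub>C b)"
    unfolding V_inv_def by (intro sum.cong) (simp_all add: coordinate)
  then show ?thesis by (simp add: basis_expansion)
qed

lemma V_inv_add: "V_inv (x + y) = V_inv x + V_inv y"
  by (metis V_V_inv V_inv_V add)

lemma V_inv_scale: "V_inv (c *\<^sub>C x) = \<sigma> c *\<^sub>C V_inv x"
  by (metis V_V_inv V_inv_V scale conj_simps(6))

lemma unitary_V_inv: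
  assumes "\<sigma> = id" shows "unitary V_inv" "cadjoint V_inv = V"
proof -
  show 1: "cadjoint V_inv = V"
  proof (rule cadjoint_eqI)
    fix x y show "cinner (V_inv x) y = cinner x (V y)"
      using cinner_image[of "V_inv x" y, unfolded V_V_inv] assms by simp
  qed
  have "\<sigma> c = c" for c using assms by simp
  then show "unitary V_inv"
    unfolding unitary_def 1 by (auto simp: bounded_operators_iff V_inv_add V_inv_scale V_V_inv V_inv_V fun_eq_iff)
qed

lemma anti_unitary_V_inv:
  assumes "\<sigma> = cnj" shows "anti_unitary V_inv" "inv V_inv = V"
proof -
  show "inv V_inv = V"
    by (rule inv_unique_comp) (auto simp: V_V_inv V_inv_V fun_eq_iff)
  have "surj V_inv" by (metis V_inv_V surjI)
  moreover have "\<sigma> c = cnj c" for c using assms by simp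
  ultimately show "anti_unitary V_inv"
    unfolding anti_unitary_def by (simp add: V_inv_add V_inv_scale norm_image[of "V_inv _", unfolded V_V_inv, symmetric])
qed

end

section \<open>Equivalence of the five conditions\<close>

theorem theorem1p2:
  fixes \<phi> :: "('h::complex_hilbert \<Rightarrow> 'h) \<Rightarrow> ('h \<Rightarrow> 'h)"
    and n :: nat
  assumes finite_dim: "\<exists>B :: 'h set. finite B \<and> complex_vector.span B = UNIV"
    and dim: "complex_vector.dim (UNIV :: 'h set) = n"
    and n_ge_3: "3 \<le> n"
    and maps_into: "\<forall>P\<in>projections. \<phi> P \<in> projections"
    and surjective: "\<forall>Q\<in>projections. \<exists>P\<in>projections. \<phi> P = Q"
  shows
    "((\<exists>k\<^sub>0\<ge>3. shrinks_joint_spectrum \<phi> k\<^sub>0) \<longleftrightarrow>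
      (\<exists>k\<^sub>0\<ge>3. preserves_joint_spectrum \<phi> k\<^sub>0)) \<and>
     ((\<exists>k\<^sub>0\<ge>3. preserves_joint_spectrum \<phi> k\<^sub>0) \<longleftrightarrow>
      (\<forall>k\<ge>3. shrinks_joint_spectrum \<phi> k)) \<and>
     ((\<forall>k\<ge>3. shrinks_joint_spectrum \<phi> k) \<longleftrightarrow>
      (\<forall>k\<ge>3. preserves_joint_spectrum \<phi> k)) \<and>
     ((\<forall>k\<ge>3. preserves_joint_spectrum \<phi> k) \<longleftrightarrow>
      (\<exists>U :: 'h \<Rightarrow> 'h.
        (unitary U \<and> (\<forall>P\<in>projections. \<phi> P = cadjoint U \<circ> P \<circ> U)) \<or>
        (anti_unitary U \<and> (\<forall>P\<in>projections. \<phi> P = inv U \<circ> P \<circ> U))))"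
proof -
  obtain D :: "'h set" where D: "finite D" "complex_vector.span D = UNIV" using finite_dim by blast
  obtain B :: "'h set" where "orthonormal_basis B"
    using orthonormal_extends_to_basis[OF D, of "{}"] by (auto simp: orthonormal_def)
  then interpret orthonormal_basis B .
  have "card B = n" using dim dim_UNIV by (simp add: dimension_def)
  then obtain b0 where b0: "b0 \<in> B" using n_ge_3 by fastforce
  define conjugation where "conjugation \<longleftrightarrow> (\<exists>U :: 'h \<Rightarrow> 'h.
    (unitary U \<and> (\<forall>P\<in>projections. \<phi> P = cadjoint U \<circ> P \<circ> U)) \<or>
    (anti_unitary U \<and> (\<forall>P\<in>projections. \<phi> P = inv U \<circ> P \<circ> U)))"
  have to_conjugation: conjugation if k: "3 \<le> k" "shrinks_joint_spectrum \<phi> k" for k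
  proof -
    interpret spectrum_shrinking B \<phi>
      by unfold_locales
        (use maps_into shrinks_joint_spectrum_triple[OF k maps_into] in blast)+
    obtain \<sigma> u where S: "semilinear_isometry B \<sigma> u"
      and inter: "\<And>P x. P \<in> projections \<Longrightarrow> \<phi> P (semilinear_map \<sigma> u x) = semilinear_map \<sigma> u (P x)"
      using intertwined_by_semilinear_isometry[OF b0] by blast
    interpret S: semilinear_isometry B \<sigma> u by (rule S)
    have form: "\<phi> P = S.V \<circ> P \<circ> S.V_inv" if "P \<in> projections" for P
      using inter[OF that, of "S.V_inv _"] by (simp add: S.V_V_inv fun_eq_iff)
    show conjugation
    proof (cases "\<sigma> = id")
      case True
      then show ?thesis unfolding conjugation_def using S.unitary_V_inv form by metis
    next
      case False
      then have "\<sigma> = cnj" using S.conj by simp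
      then show ?thesis unfolding conjugation_def using S.anti_unitary_V_inv form by metis
    qed
  qed
  have preserves: "preserves_joint_spectrum \<phi> k" if conjugation for k
  proof -
    from that obtain U where
      "(unitary U \<and> (\<forall>P\<in>projections. \<phi> P = cadjoint U \<circ> P \<circ> U)) \<or>
       (anti_unitary U \<and> (\<forall>P\<in>projections. \<phi> P = inv U \<circ> P \<circ> U))"
      unfolding conjugation_def by blast
    then show ?thesis
    proof
      assume U: "unitary U \<and> (\<forall>P\<in>projections. \<phi> P = cadjoint U \<circ> P \<circ> U)"
      then have UU: "U (cadjoint U x) = x" "cadjoint U (U x) = x" for x
        by (auto simp: unitary_def fun_eq_iff)
      have lin: "cadjoint U \<in> bounded_operators"
        using U by (simp add: unitary_def cadjoint_bounded)
      show ?thesis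
      proof (rule preserves_if_intertwined[where \<sigma> = id and V = "cadjoint U"])
        show "bij (cadjoint U)" by (rule o_bij[of U]) (auto simp: UU fun_eq_iff)
      qed (use lin U UU maps_into in \<open>auto simp: bounded_operators_iff\<close>)
    next
      assume U: "anti_unitary U \<and> (\<forall>P\<in>projections. \<phi> P = inv U \<circ> P \<circ> U)"
      then have add: "U (x + y) = U x + U y" and scale: "U (c *\<^sub>C x) = cnj c *\<^sub>C U x"
        and norm: "norm (U x) = norm x" and "surj U" for x y c
        by (auto simp: anti_unitary_def)
      have "inj U"
      proof (rule injI)
        fix x y assume "U x = U y"
        then have "U (x - y) = 0" using add[of "x - y" y] by simp
        then show "x = y" using norm[of "x - y"] by simp
      qed
      then have UU: "U (inv U x) = x" "inv U (U x) = x" for x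
        using \<open>surj U\<close> by (simp_all add: surj_f_inv_f)
      show ?thesis
      proof (rule preserves_if_intertwined[where \<sigma> = cnj and V = "inv U"])
        show "inv U (x + y) = inv U x + inv U y" for x y by (metis UU add)
        show "inv U (c *\<^sub>C x) = cnj c *\<^sub>C inv U x" for c x by (metis UU scale complex_cnj_cnj)
        show "bij (inv U)" using \<open>inj U\<close> \<open>surj U\<close> by (intro bij_imp_bij_inv bijI)
      qed (use U UU maps_into in auto)
    qed
  qed
  have shrinks: "preserves_joint_spectrum \<phi> k \<Longrightarrow> shrinks_joint_spectrum \<phi> k" for k
    unfolding preserves_joint_spectrum_def shrinks_joint_spectrum_def by blast
  show ?thesis
    unfolding conjugation_def[symmetric] using to_conjugation preserves shrinks le_refl[of 3] by blast
qed

end
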